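(* Let $A$ be the indefinite Sturm--Liouville operator associated with $-y''+qy=\lambda r y$ on $\mathbb{R}$, and let $M_+$, $M_-$ be the Weyl--Titchmarsh $m$-coefficients of this equation on $\mathbb{R}_+$ and $\mathbb{R}_-$ (all as defined in the context). If $A$ is similar to a self-adjoint operator, then the functions $$\frac{\operatorname{Im} M_+(\lambda)}{M_+(\lambda)-M_-(\lambda)}\quad\text{and}\quad \frac{\operatorname{Im} M_-(\lambda)}{M_+(\lambda)-M_-(\lambda)}$$ are well-defined and bounded on $\mathbb{C}\setminus\mathbb{R}$.
   Context: Let $q,r\in L^1_{loc}(\mathbb{R})$ be real-valued with $x\,r(x)>0$ for $x\in\mathbb{R}\setminus\{0\}$. Put $\ell[y]=\frac{1}{|r|}(-y''+qy)$ and $a[y]=\frac1r(-y''+qy)$. In the Hilbert space $L^2(\mathbb{R},|r(x)|dx)$ let $$\mathfrak{D}=\{f\in L^2(\mathbb{R},|r|dx): f,f'\in AC_{loc}(\mathbb{R}),\ \ell[f]\in L^2(\mathbb{R},|r|dx)\},$$ and let $L$ and $A$ be the operators with domain $\mathfrak{D}$ given by $Lf=\ell[f]$, $Af=a[f]$. With $(Jf)(x)=(\operatorname{sgn}x)f(x)$ one has $A=JL$. Standing assumption: $\ell[\cdot]$ is in the limit point case at $+\infty$ and $-\infty$, i.e. $L$ is self-adjoint (equivalently, $A$ is $J$-self-adjoint, meaning that $JA$ is self-adjoint). Let $c(x,\lambda)$, $s(x,\lambda)$ be the solutions of $-y''+qy=\lambda|r|y$ on $\mathbb{R}$ with $c(0,\lambda)=s'(0,\lambda)=1$,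 $c'(0,\lambda)=s(0,\lambda)=0$. Let $m_\pm:\mathbb{C}\setminus\mathbb{R}\to\mathbb{C}$ be the unique holomorphic functions such that $s(\cdot,\lambda)-m_+(\lambda)c(\cdot,\lambda)\in L^2(\mathbb{R}_+,|r|dx)$ and $s(\cdot,\lambda)+m_-(\lambda)c(\cdot,\lambda)\in L^2(\mathbb{R}_-,|r|dx)$. Set $M_\pm(\lambda)=\pm m_\pm(\pm\lambda)$; these are the Weyl--Titchmarsh $m$-coefficients for $-y''+qy=\lambda ry$ on $\mathbb{R}_\pm$. Two closed operators $T_1,T_2$ in a Hilbert space $\mathfrak{H}$ are similar if there is a bounded operator $S$ with bounded inverse on $\mathfrak{H}$ such that $S\operatorname{dom}(T_1)=\operatorname{dom}(T_2)$ and $T_2=ST_1S^{-1}$. *)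

theory Defs
  imports "HOL-Analysis.Analysis"
begin

section \<open>Operators in \<open>L\<^sup>2(M)\<close>\<close>

text \<open>
  The elements of \<open>L\<^sup>2(M)\<close> are represented by square-integrable functions, with almost everywhere
  equality as equality of vectors.  Operators are identified with their graphs, which are required
  to respect that equality.
\<close>

definition L2 :: "'a measure \<Rightarrow> ('a \<Rightarrow> complex) set" where
  "L2 M = {f \<in> borel_measurable M. integrable M (\<lambda>x. (cmod (f x))\<^sup>2)}"

definition L2_inner :: "'a measure \<Rightarrow> ('a \<Rightarrow> complex) \<Rightarrow> ('a \<Rightarrow> complex) \<Rightarrow> complex" where
  "L2_inner M f g = (LINT x|M. f x * cnj (g x))"

definition L2_norm :: "'a measure \<Rightarrow> ('a \<Rightarrow> complex) \<Rightarrow> real" where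
  "L2_norm M f = sqrt (LINT x|M. (cmod (f x))\<^sup>2)"

definition ae_eq :: "'a measure \<Rightarrow> ('a \<Rightarrow> complex) \<Rightarrow> ('a \<Rightarrow> complex) \<Rightarrow> bool" where
  "ae_eq M f g \<longleftrightarrow> (AE x in M. f x = g x)"

type_synonym 'a operator = "(('a \<Rightarrow> complex) \<times> ('a \<Rightarrow> complex)) set"

text \<open>
  The last clause says both that the operator is single-valued on almost-everywhere classes and that
  its graph contains every representative of each of its elements.  Domains are given by the library
  constant \<^const>\<open>Domain\<close>, products and inverses of operators by \<^const>\<open>relcomp\<close> and \<^const>\<open>converse\<close>.
\<close>

definition linear_operator :: "'a measure \<Rightarrow> 'a operator \<Rightarrow> bool" where
  "linear_operator M T \<longleftrightarrow>
     T \<subseteq> L2 M \<times> L2 M \<and>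
     ((\<lambda>x. 0), (\<lambda>x. 0)) \<in> T \<and>
     (\<forall>f g f' g'. (f, g) \<in> T \<longrightarrow> (f', g') \<in> T \<longrightarrow> ((\<lambda>x. f x + f' x), (\<lambda>x. g x + g' x)) \<in> T) \<and>
     (\<forall>f g a. (f, g) \<in> T \<longrightarrow> ((\<lambda>x. a * f x), (\<lambda>x. a * g x)) \<in> T) \<and>
     (\<forall>f g f' g'. (f, g) \<in> T \<longrightarrow> f' \<in> L2 M \<longrightarrow> g' \<in> L2 M \<longrightarrow> ae_eq M f f' \<longrightarrow>
        ((f', g') \<in> T \<longleftrightarrow> ae_eq M g g'))"

definition densely_defined :: "'a measure \<Rightarrow> 'a operator \<Rightarrow> bool" where
  "densely_defined M T \<longleftrightarrow>
     (\<forall>f \<in> L2 M. \<forall>\<epsilon>>0. \<exists>g \<in> Domain T. L2_norm M (\<lambda>x. f x - g x) < \<epsilon>)"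

definition adjoint_operator :: "'a measure \<Rightarrow> 'a operator \<Rightarrow> 'a operator" where
  "adjoint_operator M T =
     {(u, v). u \<in> L2 M \<and> v \<in> L2 M \<and> (\<forall>(f, g) \<in> T. L2_inner M g u = L2_inner M f v)}"

definition self_adjoint_operator :: "'a measure \<Rightarrow> 'a operator \<Rightarrow> bool" where
  "self_adjoint_operator M T \<longleftrightarrow>
     linear_operator M T \<and> densely_defined M T \<and> adjoint_operator M T = T"

definition bounded_operator :: "'a measure \<Rightarrow> 'a operator \<Rightarrow> bool" where
  "bounded_operator M S \<longleftrightarrow>
     linear_operator M S \<and> Domain S = L2 M \<and>
     (\<exists>C. \<forall>(f, g) \<in> S. L2_norm M g \<le> C * L2_norm M f)"

text \<open>
  Relational composition is read from left to right, so the last clause is \<open>T\<^sub>2 = S T\<^sub>1 S\<inverse>\<close>.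
  If one of the two operators is closed then so is the other, and self-adjoint operators are closed.
\<close>

definition similar_operators :: "'a measure \<Rightarrow> 'a operator \<Rightarrow> 'a operator \<Rightarrow> bool" where
  "similar_operators M T1 T2 \<longleftrightarrow>
     (\<exists>S. bounded_operator M S \<and> bounded_operator M (S\<inverse>) \<and>
          S `` Domain T1 = Domain T2 \<and> T2 = S\<inverse> O T1 O S)"

definition similar_to_self_adjoint :: "'a measure \<Rightarrow> 'a operator \<Rightarrow> bool" where
  "similar_to_self_adjoint M T \<longleftrightarrow>
     (\<exists>T'. self_adjoint_operator M T' \<and> similar_operators M T T')"


section \<open>Local integrability and local absolute continuity\<close>

definition L1_loc :: "(real \<Rightarrow> real) \<Rightarrow> bool" where
  "L1_loc f \<longleftrightarrow> (\<forall>a b. f absolutely_integrable_on {a..b})"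

definition AC_on :: "real \<Rightarrow> real \<Rightarrow> (real \<Rightarrow> complex) \<Rightarrow> bool" where
  "AC_on a b f \<longleftrightarrow>
     (\<forall>\<epsilon>>0. \<exists>\<delta>>0. \<forall>(n::nat) u v.
        (\<forall>i<n. a \<le> u i \<and> u i \<le> v i \<and> v i \<le> b) \<longrightarrow>
        (\<forall>i<n. \<forall>j<n. i \<noteq> j \<longrightarrow> {u i<..<v i} \<inter> {u j<..<v j} = {}) \<longrightarrow>
        (\<Sum>i<n. v i - u i) < \<delta> \<longrightarrow>
        (\<Sum>i<n. cmod (f (v i) - f (u i))) < \<epsilon>)"

definition AC_loc :: "(real \<Rightarrow> complex) \<Rightarrow> bool" where
  "AC_loc f \<longleftrightarrow> (\<forall>a b. AC_on a b f)"


section \<open>Sturm--Liouville operators\<close>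

definition ddx :: "(real \<Rightarrow> complex) \<Rightarrow> real \<Rightarrow> complex" where
  "ddx f x = vector_derivative f (at x)"

text \<open>
  If \<open>f'\<close> is (almost everywhere equal to) a locally absolutely continuous function and \<open>f\<close> is
  locally absolutely continuous, then \<open>f\<close> is continuously differentiable; hence \<open>f'\<close> is an everywhere
  defined function.  The derivative of \<open>f'\<close> exists almost everywhere only, and the values of
  \<open>ddx (ddx f)\<close> on the exceptional null set are irrelevant below.
\<close>

definition AC_loc_with_derivative :: "(real \<Rightarrow> complex) \<Rightarrow> bool" where
  "AC_loc_with_derivative f \<longleftrightarrow>
     AC_loc f \<and> (\<forall>x. f differentiable at x) \<and> AC_loc (ddx f)"

definition weighted_measure :: "(real \<Rightarrow> real) \<Rightarrow> real measure" where
  "weighted_measure r = density lebesgue (\<lambda>x. ennreal \<bar>r x\<bar>)"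

text \<open>The differential expression \<open>(-y'' + qy)/w\<close>: \<open>\<ell>\<close> for \<open>w = |r|\<close>, and \<open>a\<close> for \<open>w = r\<close>.\<close>

definition sl_expr ::
  "(real \<Rightarrow> real) \<Rightarrow> (real \<Rightarrow> real) \<Rightarrow> (real \<Rightarrow> complex) \<Rightarrow> real \<Rightarrow> complex" where
  "sl_expr q w y x = (1 / of_real (w x)) * (- ddx (ddx y) x + of_real (q x) * y x)"

definition sl_domain :: "(real \<Rightarrow> real) \<Rightarrow> (real \<Rightarrow> real) \<Rightarrow> (real \<Rightarrow> complex) set" where
  "sl_domain q r =
     {f \<in> L2 (weighted_measure r). AC_loc_with_derivative f \<and>
        sl_expr q (\<lambda>x. \<bar>r x\<bar>) f \<in> L2 (weighted_measure r)}"

text \<open>The operator given by the expression with weight \<open>w\<close> on the domain \<open>sl_domain q r\<close>.\<close>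

definition sl_operator ::
  "(real \<Rightarrow> real) \<Rightarrow> (real \<Rightarrow> real) \<Rightarrow> (real \<Rightarrow> real) \<Rightarrow> real operator" where
  "sl_operator q r w =
     {(f, g). f \<in> L2 (weighted_measure r) \<and> g \<in> L2 (weighted_measure r) \<and>
        (\<exists>y \<in> sl_domain q r. ae_eq (weighted_measure r) f y \<and>
                              ae_eq (weighted_measure r) g (sl_expr q w y))}"

definition L_operator :: "(real \<Rightarrow> real) \<Rightarrow> (real \<Rightarrow> real) \<Rightarrow> real operator" where
  "L_operator q r = sl_operator q r (\<lambda>x. \<bar>r x\<bar>)"

definition A_operator :: "(real \<Rightarrow> real) \<Rightarrow> (real \<Rightarrow> real) \<Rightarrow> real operator" where
  "A_operator q r = sl_operator q r r"


section \<open>Weyl--Titchmarsh coefficients\<close>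

definition sl_solution ::
  "(real \<Rightarrow> real) \<Rightarrow> (real \<Rightarrow> real) \<Rightarrow> complex \<Rightarrow> (real \<Rightarrow> complex) \<Rightarrow> bool" where
  "sl_solution q w z y \<longleftrightarrow>
     AC_loc_with_derivative y \<and>
     (AE x in lebesgue. - ddx (ddx y) x + of_real (q x) * y x = z * of_real (w x) * y x)"

definition fundamental_system ::
  "(real \<Rightarrow> real) \<Rightarrow> (real \<Rightarrow> real) \<Rightarrow> (real \<Rightarrow> complex \<Rightarrow> complex) \<Rightarrow> (real \<Rightarrow> complex \<Rightarrow> complex) \<Rightarrow> bool"
  where
  "fundamental_system q r c s \<longleftrightarrow>
     (\<forall>z. sl_solution q (\<lambda>x. \<bar>r x\<bar>) z (\<lambda>x. c x z) \<and> sl_solution q (\<lambda>x. \<bar>r x\<bar>) z (\<lambda>x. s x z) \<and>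
          c 0 z = 1 \<and> ddx (\<lambda>x. c x z) 0 = 0 \<and>
          s 0 z = 0 \<and> ddx (\<lambda>x. s x z) 0 = 1)"

text \<open>Values of the coefficients at real \<open>z\<close> are unconstrained.\<close>

definition is_m_plus ::
  "(real \<Rightarrow> real) \<Rightarrow> (real \<Rightarrow> complex \<Rightarrow> complex) \<Rightarrow> (real \<Rightarrow> complex \<Rightarrow> complex) \<Rightarrow> (complex \<Rightarrow> complex) \<Rightarrow> bool"
  where
  "is_m_plus r c s m \<longleftrightarrow> m holomorphic_on (- \<real>) \<and>
     (\<forall>z. z \<notin> \<real> \<longrightarrow> (\<lambda>x. s x z - m z * c x z) \<in> L2 (restrict_space (weighted_measure r) {0..}))"

definition is_m_minus ::
  "(real \<Rightarrow> real) \<Rightarrow> (real \<Rightarrow> complex \<Rightarrow> complex) \<Rightarrow> (real \<Rightarrow> complex \<Rightarrow> complex) \<Rightarrow> (complex \<Rightarrow> complex) \<Rightarrow> bool"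
  where
  "is_m_minus r c s m \<longleftrightarrow> m holomorphic_on (- \<real>) \<and>
     (\<forall>z. z \<notin> \<real> \<longrightarrow> (\<lambda>x. s x z + m z * c x z) \<in> L2 (restrict_space (weighted_measure r) {..0}))"

definition M_plus :: "(complex \<Rightarrow> complex) \<Rightarrow> complex \<Rightarrow> complex" where
  "M_plus mp z = mp z"

definition M_minus :: "(complex \<Rightarrow> complex) \<Rightarrow> complex \<Rightarrow> complex" where
  "M_minus mm z = - mm (- z)"

end

theory Submission
  imports Defs
begin

text \<open>
  If \<open>A\<close> is similar to a self-adjoint operator, then \<open>\<bar>Im \<lambda>\<bar> \<parallel>h\<parallel> \<le> C \<parallel>(A - \<lambda>) h\<parallel>\<close> for \<open>h\<close> in its domain.
  Let \<open>\<psi>\<^sub>+\<close>, \<open>\<psi>\<^sub>-\<close> be the Weyl solutions \<open>s - M\<^sub>\<plusminus> c\<close> of \<open>- y'' + q y = \<lambda> r y\<close> on the two half-lines.  If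
  \<open>M\<^sub>+ = M\<^sub>-\<close> at \<open>\<lambda>\<close>, they fit together to an eigenfunction, which contradicts the bound.  Otherwise, for
  \<open>\<alpha> = (M\<^sub>- - cnj M\<^sub>+) / (M\<^sub>+ - M\<^sub>-)\<close>, the function \<open>h\<close> equal to \<open>cnj \<psi>\<^sub>+ + \<alpha> \<psi>\<^sub>+\<close> on the right and to
  \<open>(1 + \<alpha>) \<psi>\<^sub>-\<close> on the left belongs to the domain, and \<open>(A - \<lambda>) h\<close> is \<open>(cnj \<lambda> - \<lambda>) cnj \<psi>\<^sub>+\<close> on the
  right and \<open>0\<close> on the left.  The bound on the right half-line alone yields \<open>\<bar>\<alpha>\<bar> \<le> 2 C + 1\<close>, and
  \<open>1 + \<alpha> = 2 i Im M\<^sub>+ / (M\<^sub>+ - M\<^sub>-)\<close>; the case of \<open>M\<^sub>-\<close> is symmetric.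

  Since \<^const>\<open>ddx\<close> has an unspecified value where the derivative does not exist, the linearity of
  \<open>ddx (ddx y)\<close> requires that absolutely continuous functions are differentiable almost everywhere.
  This is shown with Vitali coverings: disjoint short intervals on which a function falls steeply cover
  almost all of the set where both steep falls and steep rises occur at all scales, and inside them
  disjoint intervals with steep rises do so again, but the gaps between the latter are so short that by
  absolute continuity they cannot compensate for the rises.
\<close>


section \<open>Absolutely continuous functions and families of intervals\<close>

text \<open>Sets of endpoint pairs replace the indexed sequences of \<open>AC_on\<close>. Common
  endpoints are allowed, so that the gaps left by a family form such a family again.\<close>

definition interval_family :: "real \<Rightarrow> real \<Rightarrow> (real \<times> real) set \<Rightarrow> bool" where
  "interval_family a b G \<longleftrightarrow>
     finite G \<and> (\<forall>u v. (u, v) \<in> G \<longrightarrow> a \<le> u \<and> u < v \<and> v \<le> b) \<and>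
     (\<forall>u v u' v'. (u, v) \<in> G \<longrightarrow> (u', v') \<in> G \<longrightarrow> (u, v) = (u', v') \<or> v \<le> u' \<or> v' \<le> u)"

lemma interval_familyI:
  assumes "finite G" "\<And>u v. (u, v) \<in> G \<Longrightarrow> a \<le> u \<and> u < v \<and> v \<le> b"
    and "\<And>u v u' v'. (u, v) \<in> G \<Longrightarrow> (u', v') \<in> G \<Longrightarrow> (u, v) = (u', v') \<or> v \<le> u' \<or> v' \<le> u"
  shows "interval_family a b G"
  using assms unfolding interval_family_def by blast

lemma interval_familyD:
  assumes "interval_family a b G"
  shows "finite G" "(u, v) \<in> G \<Longrightarrow> a \<le> u \<and> u < v \<and> v \<le> b"
    and "(u, v) \<in> G \<Longrightarrow> (u', v') \<in> G \<Longrightarrow> (u, v) = (u', v') \<or> v \<le> u' \<or> v' \<le> u"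
  using assms unfolding interval_family_def by blast+

text \<open>For the identity this is the total length of the family. Keeping \<open>\<phi>\<close>
  general allows lengths and changes of a function to be compared over the same families.\<close>

definition increment :: "(real \<Rightarrow> real) \<Rightarrow> (real \<times> real) set \<Rightarrow> real" where
  "increment \<phi> G = (\<Sum>(u, v)\<in>G. \<phi> v - \<phi> u)"

lemma interval_family_subset:
  assumes "interval_family a b G" "H \<subseteq> G"
  shows "interval_family a b H"
  using interval_familyD[OF assms(1)] assms(2)
  by (intro interval_familyI) (blast intro: finite_subset)+

lemma increment_union:
  assumes "interval_family a b (G \<union> H)" "G \<inter> H = {}"
  shows "increment \<phi> (G \<union> H) = increment \<phi> G + increment \<phi> H"
  using assms unfolding increment_def interval_family_def
  by (intro sum.union_disjoint) auto

text \<open>\<open>H\<close> consists of the gaps of \<open>G\<close> in \<open>[a, b]\<close>, and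
  the increments telescope. Induction on the number of intervals: the rightmost interval is split
  off and the others are completed up to its left endpoint. \<open>H\<close> serves all
  \<open>\<phi>\<close> at once, so the identity and the function under study can be used with the
  same gaps.\<close>

lemma interval_family_complement:
  assumes "interval_family a b G" "a \<le> b"
  obtains H where "interval_family a b (G \<union> H)" "G \<inter> H = {}"
    "\<And>\<phi>. increment \<phi> G + increment \<phi> H = \<phi> b - \<phi> a"
proof -
  have "\<exists>H. interval_family a b (G \<union> H) \<and> G \<inter> H = {} \<and>
          (\<forall>\<phi>. increment \<phi> G + increment \<phi> H = \<phi> b - \<phi> a)"
    using assms
  proof (induction "card G" arbitrary: G b)
    case 0
    then have G: "G = {}" by (auto simp: interval_family_def)
    show ?case
    proof (cases "a < b")
      case True
      then show ?thesis
        by (intro exI[of _ "{(a, b)}"]) (auto simp: G intro!: interval_familyI simp: increment_def)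
    next
      case False
      then show ?thesis using 0
        by (intro exI[of _ "{}"]) (auto simp: G interval_family_def increment_def)
    qed
  next
    case (Suc n)
    have fin: "finite G" using Suc.prems by (auto simp: interval_family_def)
    have ne: "G \<noteq> {}" using Suc.hyps(2) by auto
    define V where "V = Max (snd ` G)"
    have "V \<in> snd ` G" unfolding V_def using fin ne by (intro Max_in) auto
    then obtain U where UV: "(U, V) \<in> G" by force
    have Vmax: "v \<le> V" if "(u, v) \<in> G" for u v
      unfolding V_def using fin that by (intro Max_ge) force+
    have UVb: "a \<le> U" "U < V" "V \<le> b" using interval_familyD(2)[OF Suc.prems(1) UV] by auto
    define G' where "G' = G - {(U, V)}"
    have card: "card G' = n" using Suc.hyps(2) UV fin by (simp add: G'_def)
    have left: "v \<le> U" if "(u, v) \<in> G'" for u v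
    proof -
      have uv: "(u, v) \<in> G" "(u, v) \<noteq> (U, V)" using that by (auto simp: G'_def)
      then have "v \<le> U \<or> V \<le> u" "u < v"
        using interval_familyD[OF Suc.prems(1)] UV by blast+
      then show ?thesis using UVb Vmax[OF uv(1)] by auto
    qed
    have sub: "interval_family a b G'"
      using interval_family_subset[OF Suc.prems(1), of G'] by (auto simp: G'_def)
    have "interval_family a U G'"
      using interval_familyD[OF sub] left by (intro interval_familyI) auto
    then obtain H' where H': "interval_family a U (G' \<union> H')" "G' \<inter> H' = {}"
      "\<And>\<phi>. increment \<phi> G' + increment \<phi> H' = \<phi> U - \<phi> a"
      using Suc.hyps(1)[of G' U] card UVb by blast
    \<comment> \<open>The last gap \<open>(V, b)\<close> is added only if it is nondegenerate, as
      the intervals of a family must be.\<close>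
    define R where "R = (if V < b then {(V, b)} else {})"
    have finH': "finite H'" using interval_familyD(1)[OF H'(1)] by auto
    have R: "u = V \<and> v = b \<and> V < b" if "(u, v) \<in> R" for u v
      using that by (auto simp: R_def split: if_splits)
    have leftH: "a \<le> u \<and> u < v \<and> v \<le> U" if "(u, v) \<in> G' \<union> H'" for u v
      using interval_familyD(2)[OF H'(1)] that by blast
    have all: "G \<union> (H' \<union> R) = insert (U, V) (R \<union> (G' \<union> H'))" using UV by (auto simp: G'_def)
    have disj: "H' \<inter> R = {}" "G \<inter> (H' \<union> R) = {}"
    proof -
      show "H' \<inter> R = {}" using leftH UVb R by fastforce
      have "p \<notin> H' \<union> R" if "p \<in> G" for p
      proof (cases p)
        case (Pair u v)
        show ?thesis
        proof (cases "p = (U, V)")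
          case True
          then show ?thesis using leftH[of U V] R[of U V] UVb by auto
        next
          case False
          then have "p \<in> G'" using that by (simp add: G'_def)
          then show ?thesis using H'(2) left[of u v] R[of u v] leftH[of u v] UVb Pair by auto
        qed
      qed
      then show "G \<inter> (H' \<union> R) = {}" by auto
    qed
    have "interval_family a b (G \<union> (H' \<union> R))"
    proof (rule interval_familyI)
      show "finite (G \<union> (H' \<union> R))" using fin finH' by (simp add: R_def)
      fix u v assume uv: "(u, v) \<in> G \<union> (H' \<union> R)"
      then consider "(u, v) = (U, V)" | "(u, v) \<in> R" | "(u, v) \<in> G' \<union> H'" unfolding all by blast
      then show "a \<le> u \<and> u < v \<and> v \<le> b"
        using UVb R[of u v] leftH[of u v] by cases force+
      fix u' v' assume "(u', v') \<in> G \<union> (H' \<union> R)"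
      then consider "(u', v') = (U, V)" | "(u', v') \<in> R" | "(u', v') \<in> G' \<union> H'" unfolding all by blast
      note uv' = this
      show "(u, v) = (u', v') \<or> v \<le> u' \<or> v' \<le> u"
      proof (cases "(u, v) \<in> G' \<union> H' \<and> (u', v') \<in> G' \<union> H'")
        case True
        then show ?thesis using interval_familyD(3)[OF H'(1)] by blast
      next
        case False
        have 1: "(u, v) = (U, V) \<or> (u = V \<and> v = b) \<or> v \<le> U"
          using uv R[of u v] leftH[of u v] unfolding all by blast
        have 2: "(u', v') = (U, V) \<or> (u' = V \<and> v' = b) \<or> v' \<le> U"
          using uv' R[of u' v'] leftH[of u' v'] by cases blast+
        have 3: "(u, v) = (U, V) \<or> (u = V \<and> v = b) \<or> (u', v') = (U, V) \<or> (u' = V \<and> v' = b)"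
          using False uv uv' R[of u v] R[of u' v'] unfolding all by blast
        show ?thesis using 1 2 3 UVb by auto
      qed
    qed
    moreover note disj(2)
    moreover have "increment \<phi> G + increment \<phi> (H' \<union> R) = \<phi> b - \<phi> a" for \<phi>
    proof -
      have "increment \<phi> G = (\<phi> V - \<phi> U) + increment \<phi> G'"
        unfolding increment_def G'_def using UV fin by (subst sum.remove[of _ "(U, V)"]) auto
      moreover have "increment \<phi> (H' \<union> R) = increment \<phi> H' + increment \<phi> R"
        unfolding increment_def using finH' disj by (intro sum.union_disjoint) (auto simp: R_def)
      moreover have "increment \<phi> R = \<phi> b - \<phi> V"
        using UVb by (auto simp: R_def increment_def)
      ultimately show ?thesis using H'(3)[of \<phi>] by simp
    qed
    ultimately show ?case by blast
  qed
  then show ?thesis using that by blast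
qed

section \<open>Local absolute continuity of real functions in terms of interval families\<close>

definition AC_loc_real :: "(real \<Rightarrow> real) \<Rightarrow> bool" where
  "AC_loc_real g \<longleftrightarrow>
     (\<forall>a b. \<forall>\<epsilon>>0. \<exists>\<delta>>0. \<forall>G. interval_family a b G \<longrightarrow> increment (\<lambda>x. x) G < \<delta> \<longrightarrow>
        (\<Sum>(u, v)\<in>G. \<bar>g v - g u\<bar>) < \<epsilon>)"

text \<open>The hypothesis on \<open>g\<close> is met by the real and imaginary parts of
  \<open>f\<close>. An enumeration of the family turns it into the sequences that
  \<open>AC_on\<close> speaks of.\<close>

lemma AC_loc_imp_AC_loc_real:
  assumes f: "AC_loc f" and g: "\<And>x y. \<bar>g x - g y\<bar> \<le> cmod (f x - f y)"
  shows "AC_loc_real g"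
  unfolding AC_loc_real_def
proof (intro allI impI)
  fix a b \<epsilon> :: real assume "\<epsilon> > 0"
  then have "\<exists>\<delta>>0. \<forall>(n::nat) u v.
        (\<forall>i<n. a \<le> u i \<and> u i \<le> v i \<and> v i \<le> b) \<longrightarrow>
        (\<forall>i<n. \<forall>j<n. i \<noteq> j \<longrightarrow> {u i<..<v i} \<inter> {u j<..<v j} = {}) \<longrightarrow>
        (\<Sum>i<n. v i - u i) < \<delta> \<longrightarrow>
        (\<Sum>i<n. cmod (f (v i) - f (u i))) < \<epsilon>"
    using f unfolding AC_loc_def AC_on_def by simp
  then obtain \<delta> where "\<delta> > 0" and \<delta>: "\<forall>(n::nat) u v.
        (\<forall>i<n. a \<le> u i \<and> u i \<le> v i \<and> v i \<le> b) \<longrightarrow>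
        (\<forall>i<n. \<forall>j<n. i \<noteq> j \<longrightarrow> {u i<..<v i} \<inter> {u j<..<v j} = {}) \<longrightarrow>
        (\<Sum>i<n. v i - u i) < \<delta> \<longrightarrow>
        (\<Sum>i<n. cmod (f (v i) - f (u i))) < \<epsilon>" by (elim exE conjE)
  show "\<exists>\<delta>>0. \<forall>G. interval_family a b G \<longrightarrow> increment (\<lambda>x. x) G < \<delta> \<longrightarrow>
        (\<Sum>(u, v)\<in>G. \<bar>g v - g u\<bar>) < \<epsilon>"
  proof (intro exI[of _ \<delta>] conjI allI impI)
    fix G assume G: "interval_family a b G" and len: "increment (\<lambda>x. x) G < \<delta>"
    obtain h where h: "bij_betw h {..<card G} G"
      using ex_bij_betw_nat_finite[of G] G by (auto simp: interval_family_def atLeast0LessThan)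
    have hG: "h i \<in> G" if "i < card G" for i using h that by (auto simp: bij_betw_def)
    have "(\<Sum>i<card G. cmod (f (snd (h i)) - f (fst (h i)))) < \<epsilon>"
    proof (rule \<delta>[rule_format, of _ "\<lambda>i. fst (h i)" "\<lambda>i. snd (h i)"])
      fix i assume "i < card G"
      then show "a \<le> fst (h i) \<and> fst (h i) \<le> snd (h i) \<and> snd (h i) \<le> b"
        using hG[of i] interval_familyD(2)[OF G, of "fst (h i)" "snd (h i)"] by simp
    next
        fix i j assume ij: "i < card G" "j < card G" "i \<noteq> j"
        then have "h i \<noteq> h j" using h by (auto simp: bij_betw_def inj_on_def)
        then show "{fst (h i)<..<snd (h i)} \<inter> {fst (h j)<..<snd (h j)} = {}"
          using interval_familyD(3)[OF G, of "fst (h i)" "snd (h i)" "fst (h j)" "snd (h j)"]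
            hG[OF ij(1)] hG[OF ij(2)] \<open>h i \<noteq> h j\<close> by (auto simp: prod_eq_iff)
    next
      show "(\<Sum>i<card G. snd (h i) - fst (h i)) < \<delta>"
        using len sum.reindex_bij_betw[OF h, of "\<lambda>p. snd p - fst p"]
        by (simp add: increment_def case_prod_beta)
    qed
    also have "(\<Sum>i<card G. cmod (f (snd (h i)) - f (fst (h i)))) = (\<Sum>(u, v)\<in>G. cmod (f v - f u))"
      using sum.reindex_bij_betw[OF h, of "\<lambda>p. cmod (f (snd p) - f (fst p))"]
      by (simp add: case_prod_beta)
    finally have "(\<Sum>(u, v)\<in>G. cmod (f v - f u)) < \<epsilon>" .
    moreover have "(\<Sum>(u, v)\<in>G. \<bar>g v - g u\<bar>) \<le> (\<Sum>(u, v)\<in>G. cmod (f v - f u))"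
      by (intro sum_mono) (auto simp: g)
    ultimately show "(\<Sum>(u, v)\<in>G. \<bar>g v - g u\<bar>) < \<epsilon>" by linarith
  qed (fact \<open>\<delta> > 0\<close>)
qed


section \<open>Vitali coverings\<close>

lemma measure_interval_family:
  assumes "interval_family a b G"
  shows "(\<Union>(u, v)\<in>G. {u<..<v}) \<in> lmeasurable"
    and "measure lebesgue (\<Union>(u, v)\<in>G. {u<..<v}) = increment (\<lambda>x. x) G"
proof -
  have fin: "finite G" by (rule interval_familyD(1)[OF assms])
  show "(\<Union>(u, v)\<in>G. {u<..<v}) \<in> lmeasurable"
    using fin by (intro fmeasurable.finite_UN) auto
  have "measure lebesgue (\<Union>p\<in>G. {fst p<..<snd p}) = (\<Sum>p\<in>G. measure lebesgue {fst p<..<snd p})"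
  proof (rule measure_UNION')
    show "pairwise (\<lambda>p q. disjnt {fst p<..<snd p} {fst q<..<snd q}) G"
    proof (rule pairwiseI)
      fix p q assume "p \<in> G" "q \<in> G" "p \<noteq> q"
      then have "snd p \<le> fst q \<or> snd q \<le> fst p"
        using interval_familyD(3)[OF assms, of "fst p" "snd p" "fst q" "snd q"]
        by (auto simp: prod_eq_iff)
      then show "disjnt {fst p<..<snd p} {fst q<..<snd q}" by (auto simp: disjnt_iff)
    qed
  qed (use fin in auto)
  also have "\<dots> = (\<Sum>p\<in>G. snd p - fst p)"
    using interval_familyD(2)[OF assms] by (intro sum.cong) force+
  finally show "measure lebesgue (\<Union>(u, v)\<in>G. {u<..<v}) = increment (\<lambda>x. x) G"
    by (simp add: increment_def case_prod_beta)
qed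

text \<open>The Vitali covering theorem yields countably many disjoint intervals that cover almost
  all of \<open>E\<close>; by continuity of the measure from below, finitely many of them cover
  \<open>E\<close> up to measure \<eta>. The open set \<open>U\<close> confines the intervals, so
  that one such family can be chosen inside another.\<close>

lemma Vitali_interval_family:
  fixes E U :: "real set"
  assumes E: "E \<in> lmeasurable" "E \<subseteq> U" and U: "open U" "U \<subseteq> {a<..<b}" and "\<eta> > 0"
    and K: "\<And>x d. x \<in> E \<Longrightarrow> d > 0 \<Longrightarrow> \<exists>u v. u < x \<and> x < v \<and> v - u < d \<and> K u v"
  obtains G where "interval_family a b G" "\<And>u v. (u, v) \<in> G \<Longrightarrow> K u v \<and> {u<..<v} \<subseteq> U"
    "measure lebesgue E - \<eta> < increment (\<lambda>x. x) G"
proof -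
  define K' where "K' = {p. fst p < snd p \<and> K (fst p) (snd p) \<and> {fst p..snd p} \<subseteq> U}"
  \<comment> \<open>The covering theorem is about balls: the pair of endpoints is the index, and the
    closed interval is the ball about its midpoint.\<close>
  define mid rad :: "real \<times> real \<Rightarrow> real"
    where "mid p = (fst p + snd p) / 2" and "rad p = (snd p - fst p) / 2" for p
  have cball: "cball (mid p) (rad p) = {fst p..snd p}" for p
    by (simp add: cball_eq_atLeastAtMost mid_def rad_def field_simps)
  have cov: "\<exists>p. p \<in> K' \<and> x \<in> cball (mid p) (rad p) \<and> rad p < d" if x: "x \<in> E" and "d > 0" for x d
  proof -
    obtain e where e: "e > 0" "ball x e \<subseteq> U"
      using x E U open_contains_ball by blast
    obtain u v where uv: "u < x" "x < v" "v - u < min d e" "K u v"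
      using K[OF x, of "min d e"] \<open>d > 0\<close> \<open>e > 0\<close> by auto
    then have "{u..v} \<subseteq> ball x e" by (auto simp: dist_real_def)
    then have "(u, v) \<in> K'" using uv e by (auto simp: K'_def)
    moreover have "rad (u, v) < d" using uv by (auto simp: rad_def)
    ultimately show ?thesis using uv unfolding cball by (intro exI[of _ "(u, v)"]) auto
  qed
  have pos: "0 < rad p" if "p \<in> K'" for p using that by (auto simp: K'_def rad_def)
  obtain C where C: "countable C" "C \<subseteq> K'"
    "pairwise (\<lambda>i j. disjnt (cball (mid i) (rad i)) (cball (mid j) (rad j))) C"
    "negligible (E - (\<Union>i\<in>C. cball (mid i) (rad i)))"
    by (rule Vitali_covering_theorem_cballs[OF pos cov]) blast+
  have C_props: "u < v \<and> K u v \<and> {u..v} \<subseteq> U" if "(u, v) \<in> C" for u v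
    using subsetD[OF C(2) that] by (simp add: K'_def)
  have fam: "interval_family a b G" if "G \<subseteq> C" "finite G" for G
  proof (rule interval_familyI)
    fix u v assume uv: "(u, v) \<in> G"
    then have *: "u < v" "{u..v} \<subseteq> U" using C_props[of u v] that by blast+
    then have "u \<in> U" "v \<in> U" by auto
    then show "a \<le> u \<and> u < v \<and> v \<le> b" using U * by auto
    fix u' v' assume uv': "(u', v') \<in> G"
    then have *: "u' < v'" using C_props[of u' v'] that by blast
    show "(u, v) = (u', v') \<or> v \<le> u' \<or> v' \<le> u"
    proof (rule ccontr)
      assume neg: "\<not> ?thesis"
      then have "disjnt {u..v} {u'..v'}"
        using pairwiseD[OF C(3), of "(u, v)" "(u', v')"] uv uv' that(1) unfolding cball by auto
      moreover have "max u u' \<in> {u..v}" "max u u' \<in> {u'..v'}" using neg * \<open>u < v\<close> by auto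
      ultimately show False unfolding disjnt_iff by blast
    qed
  qed (use that in auto)
  show ?thesis
  proof (cases "C = {}")
    case True
    then have "measure lebesgue E = 0" using C(4) by (simp add: negligible_imp_measure0)
    then show ?thesis
      using that[of "{}"] fam[of "{}"] \<open>\<eta> > 0\<close> by (simp add: increment_def)
  next
    case False
    \<comment> \<open>The enumeration repeats itself if \<open>C\<close> is finite; this does no
      harm, as \<open>G\<close> below is the image set of the first \<open>n\<close>
      indices.\<close>
    define e where "e = from_nat_into C"
    have ran: "range e = C" unfolding e_def using False C by (simp add: range_from_nat_into)
    define A where "A n = E \<inter> (\<Union>i<n. {fst (e i)..snd (e i)})" for n
    have meas: "A n \<in> lmeasurable" for n
      unfolding A_def using E by (intro fmeasurable.Int) auto
    have UA: "(\<Union>n. A n) = E \<inter> (\<Union>p\<in>C. {fst p..snd p})"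
      unfolding A_def ran[symmetric] by auto
    have UA_meas: "(\<Union>n. A n) \<in> lmeasurable"
      unfolding UA using E C
      by (intro fmeasurable_Int_fmeasurable sets.countable_UN') auto
    have "incseq A" unfolding A_def incseq_def by fastforce
    then have "(\<lambda>n. measure lebesgue (A n)) \<longlonglongrightarrow> measure lebesgue (\<Union>n. A n)"
      using meas UA_meas by (intro Lim_measure_incseq) (auto simp: fmeasurable_def)
    moreover have "measure lebesgue (\<Union>n. A n) = measure lebesgue E"
    proof (rule measure_negligible_symdiff)
      show "E \<in> lmeasurable" by fact
      have "(E - (\<Union>n. A n)) \<union> ((\<Union>n. A n) - E) = E - (\<Union>i\<in>C. cball (mid i) (rad i))"
        unfolding UA cball by auto
      then show "negligible ((E - (\<Union>n. A n)) \<union> ((\<Union>n. A n) - E))" using C(4) by simp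
    qed
    ultimately have "\<forall>\<^sub>F n in sequentially. measure lebesgue E - \<eta> < measure lebesgue (A n)"
      using \<open>\<eta> > 0\<close> by (intro order_tendstoD) auto
    then obtain n where n: "measure lebesgue E - \<eta> < measure lebesgue (A n)"
      by (auto simp: eventually_sequentially)
    define G where "G = e ` {..<n}"
    have G: "G \<subseteq> C" "finite G" using ran by (auto simp: G_def)
    have "measure lebesgue (A n) \<le> measure lebesgue (\<Union>p\<in>G. {fst p..snd p})"
      using meas by (intro measure_mono_fmeasurable fmeasurable.finite_UN) (auto simp: A_def G_def)
    also have "\<dots> \<le> (\<Sum>p\<in>G. measure lebesgue {fst p..snd p})"
      using G by (intro measure_UNION_le) auto
    also have "\<dots> = increment (\<lambda>x. x) G"
      unfolding increment_def using interval_familyD(2)[OF fam[OF G]]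
      by (intro sum.cong) force+
    finally have len: "measure lebesgue E - \<eta> < increment (\<lambda>x. x) G" using n by linarith
    have "K u v \<and> {u<..<v} \<subseteq> U" if "(u, v) \<in> G" for u v
      using C_props[of u v] G that by force
    then show ?thesis using that[of G] fam[OF G] len by blast
  qed
qed

section \<open>Points inside arbitrarily short intervals with a given property\<close>

definition fine_points :: "(real \<Rightarrow> real \<Rightarrow> bool) \<Rightarrow> real set" where
  "fine_points K = {x. \<forall>d>0. \<exists>u v. u < x \<and> x < v \<and> v - u < d \<and> K u v}"

text \<open>Because \<open>x\<close> lies strictly between \<open>u\<close> and \<open>v\<close>,
  the set belonging to each scale \<open>1 / Suc n\<close> is a union of open intervals, whatever
  \<open>K\<close> is. Hence \<open>fine_points K\<close> is a countable intersection of open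
  sets.\<close>

lemma fine_points_borel: "fine_points K \<in> sets borel"
proof -
  define W where "W n = {x. \<exists>u v. u < x \<and> x < v \<and> v - u < 1 / Suc n \<and> K u v}" for n
  have W: "x \<in> W n \<longleftrightarrow> (\<exists>u v. u < x \<and> x < v \<and> v - u < 1 / Suc n \<and> K u v)" for x n
    unfolding W_def by simp
  have "fine_points K = (\<Inter>n. W n)"
  proof (intro set_eqI iffI)
    fix x assume "x \<in> fine_points K"
    then show "x \<in> (\<Inter>n. W n)" by (simp add: fine_points_def W)
  next
    fix x assume x: "x \<in> (\<Inter>n. W n)"
    show "x \<in> fine_points K"
      unfolding fine_points_def
    proof (intro CollectI allI impI)
      fix d :: real assume "d > 0"
      then obtain n where "1 / Suc n < d" using nat_approx_posE by blast
      moreover have "x \<in> W n" using x by blast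
      ultimately show "\<exists>u v. u < x \<and> x < v \<and> v - u < d \<and> K u v"
        unfolding W by (meson order.strict_trans)
    qed
  qed
  moreover have "open (W n)" for n
    unfolding W_def
    by (intro open_Collect_ex open_Collect_conj open_Collect_less open_Collect_const continuous_intros)
  ultimately show ?thesis by auto
qed

lemma negligible_on_open_intervals:
  assumes "\<And>a b. negligible (E \<inter> {a<..<b::real})"
  shows "negligible E"
  unfolding negligible_on_intervals[of E]
proof (intro allI)
  fix a b :: real
  show "negligible (E \<inter> cbox a b)"
    by (rule negligible_subset[OF assms[of "a - 1" "b + 1"]]) auto
qed

lemma lmeasurable_open_superset:
  fixes E :: "real set"
  assumes "E \<in> sets lebesgue" "E \<subseteq> {a<..<b}" "\<eta> > 0"
  obtains U where "open U" "E \<subseteq> U" "U \<subseteq> {a<..<b}" "U - E \<in> lmeasurable" "measure lebesgue (U - E) < \<eta>"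
proof -
  obtain T where T: "open T" "E \<subseteq> T" "T - E \<in> lmeasurable" "emeasure lebesgue (T - E) < ennreal \<eta>"
    using sets_lebesgue_outer_open[OF assms(1,3)] by blast
  have "measure lebesgue (T - E) < \<eta>"
    using T(3,4) \<open>\<eta> > 0\<close> by (simp add: emeasure_eq_measure2 ennreal_less_iff)
  moreover have *: "T \<inter> {a<..<b} - E \<in> lmeasurable"
    using T assms(1) by (intro fmeasurableI2[OF T(3)]) auto
  moreover have "measure lebesgue (T \<inter> {a<..<b} - E) \<le> measure lebesgue (T - E)"
    using T(3) * by (intro measure_mono_fmeasurable) auto
  ultimately show ?thesis
    using that[of "T \<inter> {a<..<b}"] T assms by (auto simp: open_Int)
qed


section \<open>Almost everywhere differentiability\<close>

lemma lmeasurable_subset_interval: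
  assumes "E \<in> sets lebesgue" "E \<subseteq> {a<..<b::real}"
  shows "E \<in> lmeasurable"
  by (rule fmeasurableI2[OF _ assms(2,1)]) auto

lemma AC_loc_realD:
  assumes "AC_loc_real g" "\<epsilon> > 0"
  obtains \<delta> where "\<delta> > 0"
    "\<And>G. interval_family a b G \<Longrightarrow> increment (\<lambda>x. x) G < \<delta> \<Longrightarrow> (\<Sum>(u, v)\<in>G. \<bar>g v - g u\<bar>) < \<epsilon>"
  using assms unfolding AC_loc_real_def by (meson assms)

lemma increment_mono:
  assumes "\<And>u v. (u, v) \<in> G \<Longrightarrow> \<phi> v - \<phi> u \<le> \<psi> v - \<psi> u"
  shows "increment \<phi> G \<le> increment \<psi> G"
  unfolding increment_def using assms by (intro sum_mono) auto

lemma increment_scale: "increment (\<lambda>x. k * \<phi> x) G = k * increment \<phi> G"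
  unfolding increment_def by (simp add: sum_distrib_left case_prod_beta right_diff_distrib)

lemma abs_increment_le: "\<bar>increment g G\<bar> \<le> (\<Sum>(u, v)\<in>G. \<bar>g v - g u\<bar>)"
  unfolding increment_def by (rule order_trans[OF sum_abs]) (simp add: case_prod_beta)

text \<open>Let \<open>F\<close> be the family of falls, \<open>G\<close> the family of rises inside
  \<open>F\<close>, and \<open>J\<close> the gaps of \<open>G\<close> in \<open>F\<close>. The
  increment of \<open>g\<close> over \<open>J\<close> is that over \<open>F\<close> minus that over
  \<open>G\<close>, hence at most \<open>- \<epsilon>\<close> times the total length of
  \<open>F\<close> and \<open>G\<close>. But \<open>J\<close> is short, so absolute continuity
  bounds this increment below by \<open>- \<eta>\<close>. Thus \<open>F\<close> has length at most
  \<open>\<eta> / \<epsilon>\<close>, and \<open>E\<close> is not much larger.\<close>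

lemma AC_oscillation_negligible:
  assumes g: "AC_loc_real g" and "\<epsilon> > 0"
  shows "negligible (fine_points (\<lambda>u v. \<epsilon> * (v - u) \<le> g v - g u) \<inter>
                     fine_points (\<lambda>u v. g v - g u \<le> - \<epsilon> * (v - u)))"
    (is "negligible (fine_points ?P \<inter> fine_points ?N)")
proof (rule negligible_on_open_intervals)
  fix a b :: real
  define E where "E = fine_points ?P \<inter> fine_points ?N \<inter> {a<..<b}"
  have "fine_points ?P \<inter> fine_points ?N \<inter> {a<..<b} \<in> sets borel"
    using fine_points_borel by auto
  then have Es: "E \<in> sets lebesgue" unfolding E_def by auto
  then have Em: "E \<in> lmeasurable"
    by (rule lmeasurable_subset_interval[of _ a b]) (auto simp: E_def)
  have bound: "measure lebesgue E \<le> \<eta> * (1 / \<epsilon> + 1)" if "\<eta> > 0" "a < b" for \<eta>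
  proof -
    obtain \<delta>0 where "\<delta>0 > 0" and \<delta>0: "\<And>G. interval_family a b G \<Longrightarrow> increment (\<lambda>x. x) G < \<delta>0 \<Longrightarrow>
        (\<Sum>(u, v)\<in>G. \<bar>g v - g u\<bar>) < \<eta>"
      using AC_loc_realD[OF g \<open>\<eta> > 0\<close>] by blast
    \<comment> \<open>Three losses of \<open>\<delta> / 4\<close> occur: the excess of
      \<open>U\<close> over \<open>E\<close>, and the parts of \<open>E\<close> missed by
      \<open>F\<close> and by \<open>G\<close>. The first and the last bound the length of
      \<open>J\<close> by \<open>\<delta> / 2\<close>; the remaining one is absorbed at the end by
      \<open>\<delta> \<le> \<eta>\<close>.\<close>
    define \<delta> where "\<delta> = min \<delta>0 \<eta>"
    have \<delta>: "\<delta> > 0" "\<delta> \<le> \<delta>0" "\<delta> \<le> \<eta>" using \<open>\<delta>0 > 0\<close> \<open>\<eta> > 0\<close> by (auto simp: \<delta>_def)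
    obtain U where U: "open U" "E \<subseteq> U" "U \<subseteq> {a<..<b}" "U - E \<in> lmeasurable"
      "measure lebesgue (U - E) < \<delta> / 4"
      using lmeasurable_open_superset[OF Es, of a b "\<delta> / 4"] \<delta> by (auto simp: E_def)
    have EN: "\<exists>u v. u < x \<and> x < v \<and> v - u < d \<and> ?N u v" if "x \<in> E" "d > 0" for x d
      using that unfolding E_def fine_points_def by blast
    have EP: "\<exists>u v. u < x \<and> x < v \<and> v - u < d \<and> ?P u v" if "x \<in> E" "d > 0" for x d
      using that unfolding E_def fine_points_def by blast
    have \<delta>4: "\<delta> / 4 > 0" using \<delta> by simp
    obtain F where F: "interval_family a b F" "\<And>u v. (u, v) \<in> F \<Longrightarrow> ?N u v \<and> {u<..<v} \<subseteq> U"
      "measure lebesgue E - \<delta> / 4 < increment (\<lambda>x. x) F"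
      by (rule Vitali_interval_family[OF Em U(2,1,3) \<delta>4 EN]) blast+
    define U1 where "U1 = (\<Union>(u, v)\<in>F. {u<..<v})"
    have U1: "open U1" "U1 \<subseteq> U" "U1 \<in> lmeasurable" "measure lebesgue U1 = increment (\<lambda>x. x) F"
      using F(2) measure_interval_family[OF F(1)] by (auto simp: U1_def)
    have E1: "E \<inter> U1 \<in> lmeasurable" using Em U1 by (intro fmeasurable.Int)
    obtain G where G: "interval_family a b G" "\<And>u v. (u, v) \<in> G \<Longrightarrow> ?P u v \<and> {u<..<v} \<subseteq> U1"
      "measure lebesgue (E \<inter> U1) - \<delta> / 4 < increment (\<lambda>x. x) G"
      by (rule Vitali_interval_family[OF E1 _ U1(1) _ \<delta>4, of a b ?P]) (use EP U U1 in blast)+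
    have "measure lebesgue U1 \<le> measure lebesgue (E \<inter> U1) + measure lebesgue (U1 - E)"
    proof -
      have "U1 = (E \<inter> U1) \<union> (U1 - E)" by auto
      then show ?thesis
        using measure_Un_le[of "E \<inter> U1" lebesgue "U1 - E"] E1 U1 Em by (metis fmeasurableD fmeasurable_Diff)
    qed
    also have "measure lebesgue (U1 - E) \<le> measure lebesgue (U - E)"
      using U U1 Em by (intro measure_mono_fmeasurable) (auto dest: fmeasurableD)
    finally have lenG: "increment (\<lambda>x. x) F - \<delta> / 2 < increment (\<lambda>x. x) G"
      using U(5) G(3) U1(4) by linarith
    \<comment> \<open>Complements are available in \<open>[a, b]\<close> only, so the gaps of
      \<open>G\<close> in \<open>F\<close> are obtained as the complement of
      \<open>G \<union> H\<close>, where \<open>H\<close> is the complement of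
      \<open>F\<close>.\<close>
    obtain H where H: "interval_family a b (F \<union> H)" "F \<inter> H = {}"
      "\<And>\<phi>. increment \<phi> F + increment \<phi> H = \<phi> b - \<phi> a"
      using interval_family_complement[OF F(1)] \<open>a < b\<close> by (metis less_imp_le)
    \<comment> \<open>Intervals of \<open>G\<close> lie in the union of \<open>F\<close>: a common
      inner point with an interval of \<open>H\<close> would lie inside an interval of
      \<open>F\<close>, which does not overlap \<open>H\<close>.\<close>
    have sep: "v \<le> u' \<or> v' \<le> u" if "(u, v) \<in> G" "(u', v') \<in> H" for u v u' v'
    proof (rule ccontr)
      assume neg: "\<not> ?thesis"
      have "u < v" "u' < v'"
        using interval_familyD(2)[OF G(1) that(1)] interval_familyD(2)[OF H(1)] that(2) by blast+
      then have "max u u' < min v v'" using neg by auto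
      then obtain t where "max u u' < t" "t < min v v'" using dense by blast
      then have t: "t \<in> {u<..<v}" "t \<in> {u'<..<v'}" by auto
      then have "t \<in> U1" using G(2)[OF that(1)] by blast
      then obtain u'' v'' where *: "(u'', v'') \<in> F" "u'' < t" "t < v''" by (auto simp: U1_def)
      moreover have "(u'', v'') \<noteq> (u', v')" using * that(2) H(2) by auto
      ultimately show False
        using interval_familyD(3)[OF H(1), of u'' v'' u' v'] that(2) t by auto
    qed
    have disj: "G \<inter> H = {}"
      using sep interval_familyD(2)[OF G(1)] by (fastforce simp: disjoint_iff)
    have GH: "interval_family a b (G \<union> H)"
    proof (rule interval_familyI)
      show "finite (G \<union> H)"
        using interval_familyD(1)[OF G(1)] interval_familyD(1)[OF H(1)] by auto
      fix u v assume uv: "(u, v) \<in> G \<union> H"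
      then show "a \<le> u \<and> u < v \<and> v \<le> b"
        using interval_familyD(2)[OF G(1)] interval_familyD(2)[OF H(1)] by blast
      fix u' v' assume uv': "(u', v') \<in> G \<union> H"
      show "(u, v) = (u', v') \<or> v \<le> u' \<or> v' \<le> u"
        using uv uv' sep[of u v u' v'] sep[of u' v' u v] interval_familyD(3)[OF G(1), of u v u' v']
          interval_familyD(3)[OF H(1), of u v u' v'] by blast
    qed
    obtain J where J: "interval_family a b ((G \<union> H) \<union> J)" "(G \<union> H) \<inter> J = {}"
      "\<And>\<phi>. increment \<phi> (G \<union> H) + increment \<phi> J = \<phi> b - \<phi> a"
      using interval_family_complement[OF GH] \<open>a < b\<close> by (metis less_imp_le)
    have eq: "increment \<phi> G + increment \<phi> J = increment \<phi> F" for \<phi>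
      using J(3)[of \<phi>] H(3)[of \<phi>] increment_union[OF GH disj, of \<phi>] by linarith
    have "increment (\<lambda>x. x) J < \<delta>0"
      using eq[of "\<lambda>x. x"] lenG \<delta> by linarith
    then have "(\<Sum>(u, v)\<in>J. \<bar>g v - g u\<bar>) < \<eta>"
      using interval_family_subset[OF J(1)] by (intro \<delta>0) auto
    then have "- \<eta> \<le> increment g J" using abs_increment_le[of g J] by linarith
    moreover have "increment g F \<le> increment (\<lambda>x. - \<epsilon> * x) F"
      using F(2) by (intro increment_mono) (auto simp: algebra_simps)
    moreover have "increment (\<lambda>x. \<epsilon> * x) G \<le> increment g G"
      using G(2) by (intro increment_mono) (auto simp: algebra_simps)
    ultimately have "\<epsilon> * increment (\<lambda>x. x) F + \<epsilon> * increment (\<lambda>x. x) G \<le> \<eta>"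
      using eq[of g] unfolding increment_scale by linarith
    moreover have "0 \<le> \<epsilon> * increment (\<lambda>x. x) G"
      using \<open>\<epsilon> > 0\<close> interval_familyD(2)[OF G(1)] unfolding increment_def
      by (intro mult_nonneg_nonneg sum_nonneg) force+
    ultimately have "\<epsilon> * increment (\<lambda>x. x) F \<le> \<eta>" by linarith
    then have "increment (\<lambda>x. x) F \<le> \<eta> / \<epsilon>"
      using \<open>\<epsilon> > 0\<close> by (simp add: field_simps)
    then have "measure lebesgue E \<le> \<eta> / \<epsilon> + \<eta>" using F(3) \<delta> by linarith
    then show ?thesis by (simp add: algebra_simps)
  qed
  have "measure lebesgue E = 0"
  proof (cases "a < b")
    case True
    have "measure lebesgue E \<le> 0 + e" if "e > 0" for e
    proof -
      have *: "1 / \<epsilon> + 1 > 0" using \<open>\<epsilon> > 0\<close> by (simp add: add_pos_pos)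
      then show ?thesis using bound[of "e / (1 / \<epsilon> + 1)"] that True by simp
    qed
    then have "measure lebesgue E \<le> 0" by (rule field_le_epsilon)
    then show ?thesis using measure_nonneg[of lebesgue E] by linarith
  next
    case False
    then have "E = {}" by (auto simp: E_def)
    then show ?thesis by simp
  qed
  then have "negligible E" using Em by (simp add: negligible_iff_measure)
  then show "negligible (fine_points ?P \<inter> fine_points ?N \<inter> {a<..<b})" by (simp add: E_def)
qed

text \<open>Otherwise some part \<open>E\<close> of the set has positive measure inside an interval
  shorter than \<open>\<delta>\<close>. A Vitali family of intervals with slopes at least
  \<open>k\<close> in absolute value is then shorter than \<open>\<delta>\<close>, while
  \<open>g\<close> varies over it by more than \<open>k\<close> times half the measure of
  \<open>E\<close>. For large \<open>k\<close> this exceeds the bound 1 that \<open>\<delta>\<close>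
  guarantees.\<close>

lemma AC_infinite_slope_negligible:
  assumes g: "AC_loc_real g"
  shows "negligible (\<Inter>k. fine_points (\<lambda>u v. real k * (v - u) \<le> \<bar>g v - g u\<bar>))"
    (is "negligible (\<Inter>k. fine_points (?P k))")
proof (rule negligible_on_open_intervals)
  fix a b :: real
  define E0 where "E0 = (\<Inter>k. fine_points (?P k)) \<inter> {a<..<b}"
  have E0s: "E0 \<in> sets borel" unfolding E0_def using fine_points_borel by auto
  obtain \<delta> where "\<delta> > 0" and \<delta>: "\<And>G. interval_family a b G \<Longrightarrow> increment (\<lambda>x. x) G < \<delta> \<Longrightarrow>
        (\<Sum>(u, v)\<in>G. \<bar>g v - g u\<bar>) < 1"
    using AC_loc_realD[OF g zero_less_one] by blast
  \<comment> \<open>The length \<open>2 * \<delta> / 3\<close> of the window bounds the total length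
    of every family inside it.\<close>
  have "negligible (E0 \<inter> {c - \<delta> / 3<..<c + \<delta> / 3})" for c
  proof -
    define U where "U = {c - \<delta> / 3<..<c + \<delta> / 3} \<inter> {a<..<b}"
    define E where "E = E0 \<inter> {c - \<delta> / 3<..<c + \<delta> / 3}"
    have E: "E \<in> lmeasurable" "E \<subseteq> U"
    proof -
      have "E \<in> sets lebesgue" using E0s by (auto simp: E_def)
      then show "E \<in> lmeasurable"
        by (rule lmeasurable_subset_interval[of _ a b]) (auto simp: E_def E0_def)
    qed (auto simp: E_def U_def E0_def)
    have "measure lebesgue E = 0"
    proof (rule ccontr)
      assume "measure lebesgue E \<noteq> 0"
      then have pos: "measure lebesgue E / 2 > 0" using measure_nonneg[of lebesgue E] by linarith
      then obtain k :: nat where k: "1 / (measure lebesgue E / 2) < k" using reals_Archimedean2 by blast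
      have EP: "\<exists>u v. u < x \<and> x < v \<and> v - u < d \<and> ?P k u v" if "x \<in> E" "d > 0" for x d
        using that unfolding E_def E0_def fine_points_def by blast
      have U: "open U" "U \<subseteq> {a<..<b}" by (auto simp: U_def)
      obtain G where G: "interval_family a b G" "\<And>u v. (u, v) \<in> G \<Longrightarrow> ?P k u v \<and> {u<..<v} \<subseteq> U"
        "measure lebesgue E - measure lebesgue E / 2 < increment (\<lambda>x. x) G"
        by (rule Vitali_interval_family[OF E U pos EP]) blast+
      have "(\<Union>(u, v)\<in>G. {u<..<v}) \<subseteq> U" using G(2) by blast
      then have "(\<Union>(u, v)\<in>G. {u<..<v}) \<subseteq> {c - \<delta> / 3<..<c + \<delta> / 3}" unfolding U_def by blast
      then have "increment (\<lambda>x. x) G \<le> measure lebesgue {c - \<delta> / 3<..<c + \<delta> / 3}"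
        unfolding measure_interval_family(2)[OF G(1), symmetric]
        using measure_interval_family(1)[OF G(1)] by (intro measure_mono_fmeasurable) auto
      also have "\<dots> < \<delta>" using \<open>\<delta> > 0\<close> by simp
      finally have "(\<Sum>(u, v)\<in>G. \<bar>g v - g u\<bar>) < 1" by (intro \<delta> G)
      moreover have "real k * increment (\<lambda>x. x) G \<le> (\<Sum>(u, v)\<in>G. \<bar>g v - g u\<bar>)"
        unfolding increment_def sum_distrib_left using G(2) by (intro sum_mono) auto
      moreover have "1 < real k * increment (\<lambda>x. x) G"
      proof -
        have "1 < real k * (measure lebesgue E / 2)" using k pos by (simp add: field_simps)
        also have "\<dots> \<le> real k * increment (\<lambda>x. x) G" using G(3) by (intro mult_left_mono) auto
        finally show ?thesis .
      qed
      ultimately show False by linarith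
    qed
    then show ?thesis using E by (simp add: negligible_iff_measure E_def)
  qed
  note loc = this
  have "negligible E0"
    unfolding locally_negligible_alt[of E0]
  proof
    fix x assume "x \<in> E0"
    then show "\<exists>U. openin (top_of_set E0) U \<and> x \<in> U \<and> negligible U"
      using loc[of x] \<open>\<delta> > 0\<close>
      by (intro exI[of _ "E0 \<inter> {x - \<delta> / 3<..<x + \<delta> / 3}"]) (auto intro: openin_open_Int)
  qed
  then show "negligible ((\<Inter>k. fine_points (?P k)) \<inter> {a<..<b})" by (simp add: E0_def)
qed

lemma AC_loc_real_diff_linear:
  assumes g: "AC_loc_real g"
  shows "AC_loc_real (\<lambda>x. g x - m * x)"
  unfolding AC_loc_real_def
proof (intro allI impI)
  fix a b \<epsilon> :: real assume "\<epsilon> > 0"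
  then have "\<epsilon> / 2 > 0" by simp
  then obtain \<delta> where "\<delta> > 0" and \<delta>: "\<And>G. interval_family a b G \<Longrightarrow> increment (\<lambda>x. x) G < \<delta> \<Longrightarrow>
      (\<Sum>(u, v)\<in>G. \<bar>g v - g u\<bar>) < \<epsilon> / 2"
    using AC_loc_realD[OF g] by blast
  \<comment> \<open>The second bound leaves at most \<open>\<epsilon> / 2\<close> for the linear
    term; the summand 1 covers \<open>m = 0\<close>.\<close>
  define \<delta>' where "\<delta>' = min \<delta> (\<epsilon> / (2 * (\<bar>m\<bar> + 1)))"
  show "\<exists>\<delta>>0. \<forall>G. interval_family a b G \<longrightarrow> increment (\<lambda>x. x) G < \<delta> \<longrightarrow>
      (\<Sum>(u, v)\<in>G. \<bar>(g v - m * v) - (g u - m * u)\<bar>) < \<epsilon>"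
  proof (intro exI[of _ \<delta>'] conjI allI impI)
    show "\<delta>' > 0" using \<open>\<delta> > 0\<close> \<open>\<epsilon> > 0\<close> by (simp add: \<delta>'_def)
    fix G assume G: "interval_family a b G" "increment (\<lambda>x. x) G < \<delta>'"
    have le: "u \<le> v" if "(u, v) \<in> G" for u v using interval_familyD(2)[OF G(1) that] by simp
    have "(\<Sum>(u, v)\<in>G. \<bar>(g v - m * v) - (g u - m * u)\<bar>) \<le>
        (\<Sum>(u, v)\<in>G. \<bar>g v - g u\<bar> + \<bar>m\<bar> * (v - u))"
    proof (intro sum_mono, clarify)
      fix u v assume "(u, v) \<in> G"
      have "\<bar>(g v - m * v) - (g u - m * u)\<bar> = \<bar>(g v - g u) - m * (v - u)\<bar>"
        by (simp add: algebra_simps)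
      also have "\<dots> \<le> \<bar>g v - g u\<bar> + \<bar>m * (v - u)\<bar>" by (rule abs_triangle_ineq4)
      finally show "\<bar>(g v - m * v) - (g u - m * u)\<bar> \<le> \<bar>g v - g u\<bar> + \<bar>m\<bar> * (v - u)"
        using le[OF \<open>(u, v) \<in> G\<close>] by (simp add: abs_mult)
    qed
    also have "\<dots> = (\<Sum>(u, v)\<in>G. \<bar>g v - g u\<bar>) + \<bar>m\<bar> * increment (\<lambda>x. x) G"
      by (simp add: increment_def sum.distrib case_prod_beta sum_distrib_left)
    also have "(\<Sum>(u, v)\<in>G. \<bar>g v - g u\<bar>) < \<epsilon> / 2"
      using G by (intro \<delta>) (auto simp: \<delta>'_def)
    also have "\<bar>m\<bar> * increment (\<lambda>x. x) G \<le> (\<bar>m\<bar> + 1) * \<delta>'"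
    proof (rule mult_mono)
      show "0 \<le> increment (\<lambda>x. x) G" using le unfolding increment_def by (intro sum_nonneg) auto
    qed (use G in auto)
    also have "(\<bar>m\<bar> + 1) * \<delta>' \<le> (\<bar>m\<bar> + 1) * (\<epsilon> / (2 * (\<bar>m\<bar> + 1)))"
      by (intro mult_left_mono) (auto simp: \<delta>'_def)
    also have "\<dots> = \<epsilon> / 2" by (simp add: add_pos_nonneg field_simps)
    finally show "(\<Sum>(u, v)\<in>G. \<bar>(g v - m * v) - (g u - m * u)\<bar>) < \<epsilon>" by simp
  qed
qed

text \<open>Subtracting a linear function of slope \<open>(p + q) / 2\<close> makes the two
  thresholds opposite, namely \<open>(q - p) / 2\<close> and its negative.\<close>

lemma AC_slope_gap_negligible:
  assumes g: "AC_loc_real g" and "p < q"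
  shows "negligible (fine_points (\<lambda>u v. q * (v - u) \<le> g v - g u) \<inter>
                     fine_points (\<lambda>u v. g v - g u \<le> p * (v - u)))"
proof -
  define h where "h x = g x - (p + q) / 2 * x" for x
  have "AC_loc_real h" unfolding h_def by (rule AC_loc_real_diff_linear[OF g])
  then have "negligible (fine_points (\<lambda>u v. (q - p) / 2 * (v - u) \<le> h v - h u) \<inter>
                     fine_points (\<lambda>u v. h v - h u \<le> - ((q - p) / 2) * (v - u)))"
    using \<open>p < q\<close> by (intro AC_oscillation_negligible) auto
  moreover have "(q - p) / 2 * (v - u) \<le> h v - h u \<longleftrightarrow> q * (v - u) \<le> g v - g u"
      "h v - h u \<le> - ((q - p) / 2) * (v - u) \<longleftrightarrow> g v - g u \<le> p * (v - u)" for u v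
  proof -
    have "h v - h u = (g v - g u) - (p + q) / 2 * (v - u)"
      and "(q - p) / 2 * (v - u) + (p + q) / 2 * (v - u) = q * (v - u)"
      and "- ((q - p) / 2) * (v - u) + (p + q) / 2 * (v - u) = p * (v - u)"
      by (simp_all add: h_def algebra_simps add_divide_distrib diff_divide_distrib)
    then show "(q - p) / 2 * (v - u) \<le> h v - h u \<longleftrightarrow> q * (v - u) \<le> g v - g u"
      "h v - h u \<le> - ((q - p) / 2) * (v - u) \<longleftrightarrow> g v - g u \<le> p * (v - u)"
      by argo+
  qed
  ultimately show ?thesis by simp
qed

text \<open>A difference quotient at \<open>x\<close> concerns an interval that ends at
  \<open>x\<close>. By continuity this endpoint can be pushed slightly beyond \<open>x\<close>
  without losing the strict inequality, which puts \<open>x\<close> inside, as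
  \<open>fine_points\<close> demands.\<close>

lemma straddling_interval:
  fixes \<phi> :: "real \<Rightarrow> real"
  assumes "isCont \<phi> x" "t \<noteq> x" "\<bar>t - x\<bar> < d" "(\<phi> t - \<phi> x) / (t - x) > 0"
  obtains u v where "u < x" "x < v" "v - u < d" "\<phi> u < \<phi> v"
proof (cases "t > x")
  case True
  then have "\<phi> x < \<phi> t" using assms(4) by (simp add: zero_less_divide_iff)
  then have "\<forall>\<^sub>F u in at x. \<phi> u < \<phi> t"
    using assms(1) unfolding isCont_def by (rule order_tendstoD(2)[rotated])
  then obtain e where e: "e > 0" "\<And>u. u \<noteq> x \<Longrightarrow> dist u x < e \<Longrightarrow> \<phi> u < \<phi> t"
    unfolding eventually_at by auto
  define m where "m = min e (d - (t - x))"
  have m: "0 < m" "m \<le> e" "m \<le> d - (t - x)" using e(1) assms(3) by (auto simp: m_def)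
  define u where "u = x - m / 2"
  have "u < x" "dist u x < e" "t - u < d"
    using m by (auto simp: u_def dist_real_def)
  then show ?thesis using that[of u t] True e(2)[of u] by auto
next
  case False
  then have "t < x" using assms(2) by auto
  then have "\<phi> t < \<phi> x" using assms(4) by (simp add: zero_less_divide_iff)
  then have "\<forall>\<^sub>F u in at x. \<phi> t < \<phi> u"
    using assms(1) unfolding isCont_def by (rule order_tendstoD(1)[rotated])
  then obtain e where e: "e > 0" "\<And>u. u \<noteq> x \<Longrightarrow> dist u x < e \<Longrightarrow> \<phi> t < \<phi> u"
    unfolding eventually_at by auto
  define m where "m = min e (d - (x - t))"
  have m: "0 < m" "m \<le> e" "m \<le> d - (x - t)" using e(1) assms(3) by (auto simp: m_def)
  define u where "u = x + m / 2"
  have "x < u" "dist u x < e" "u - t < d"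
    using m by (auto simp: u_def dist_real_def)
  then show ?thesis using that[of t u] \<open>t < x\<close> e(2)[of u] by auto
qed

lemma AC_loc_real_isCont:
  assumes g: "AC_loc_real g"
  shows "isCont g x"
  unfolding isCont_def
proof (rule tendstoI)
  fix \<epsilon> :: real assume "\<epsilon> > 0"
  then obtain \<delta> where "\<delta> > 0" and \<delta>: "\<And>G. interval_family (x - 1) (x + 1) G \<Longrightarrow> increment (\<lambda>x. x) G < \<delta> \<Longrightarrow>
      (\<Sum>(u, v)\<in>G. \<bar>g v - g u\<bar>) < \<epsilon>"
    using AC_loc_realD[OF g] by blast
  show "\<forall>\<^sub>F t in at x. dist (g t) (g x) < \<epsilon>"
    unfolding eventually_at
  proof (intro exI[of _ "min \<delta> 1"] conjI ballI impI)
    show "min \<delta> 1 > 0" using \<open>\<delta> > 0\<close> by simp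
    fix t assume t: "t \<noteq> x \<and> dist t x < min \<delta> 1"
    define G where "G = {(min t x, max t x)}"
    have "interval_family (x - 1) (x + 1) G"
      using t by (intro interval_familyI) (auto simp: G_def dist_real_def)
    moreover have "increment (\<lambda>x. x) G < \<delta>"
      using t by (auto simp: G_def increment_def dist_real_def)
    ultimately have "(\<Sum>(u, v)\<in>G. \<bar>g v - g u\<bar>) < \<epsilon>" by (rule \<delta>)
    then show "dist (g t) (g x) < \<epsilon>"
      by (auto simp: G_def dist_real_def min_def max_def split: if_splits)
  qed
qed

lemma frequently_slope_fine_points:
  fixes \<phi> :: "real \<Rightarrow> real"
  assumes cont: "isCont \<phi> x" and fr: "\<exists>\<^sub>F t in at x. (\<phi> t - \<phi> x) / (t - x) > 0"
  shows "x \<in> fine_points (\<lambda>u v. \<phi> u < \<phi> v)"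
  unfolding fine_points_def
proof (intro CollectI allI impI)
  fix d :: real assume "d > 0"
  then have "\<forall>\<^sub>F t in at x. t \<noteq> x \<and> \<bar>t - x\<bar> < d"
    unfolding eventually_at by (intro exI[of _ d]) (auto simp: dist_real_def)
  then obtain t where "t \<noteq> x" "\<bar>t - x\<bar> < d" "(\<phi> t - \<phi> x) / (t - x) > 0"
    using frequently_ex[OF frequently_eventually_conj[OF fr]] by blast
  then show "\<exists>u v. u < x \<and> x < v \<and> v - u < d \<and> \<phi> u < \<phi> v"
    using straddling_interval[OF cont] by metis
qed

lemma fine_points_mono:
  assumes "x \<in> fine_points K" "\<And>u v. u < v \<Longrightarrow> K u v \<Longrightarrow> K' u v"
  shows "x \<in> fine_points K'"
  using assms unfolding fine_points_def by (smt (verit, ccfv_threshold) mem_Collect_eq)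

text \<open>Off a countable union of null sets the difference quotient at \<open>x\<close> is
  eventually bounded, and for no rationals \<open>p < q\<close> is it both frequently below
  \<open>p\<close> and frequently above \<open>q\<close>. So its lower and upper limits coincide and
  are finite.\<close>

lemma AC_loc_real_differentiable:
  assumes g: "AC_loc_real g"
  shows "negligible {x. \<not> g differentiable at x}"
proof -
  define N where "N p q = fine_points (\<lambda>u v. q * (v - u) \<le> g v - g u) \<inter>
                          fine_points (\<lambda>u v. g v - g u \<le> p * (v - u))" for p q
  define Ninf where "Ninf = (\<Inter>k. fine_points (\<lambda>u v. real k * (v - u) \<le> \<bar>g v - g u\<bar>))"
  define I where "I = {(p, q). p \<in> \<rat> \<and> q \<in> \<rat> \<and> p < (q::real)}"
  have "countable I"
    by (rule countable_subset[of _ "\<rat> \<times> \<rat>"]) (auto simp: I_def countable_rat)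
  then have null: "negligible (Ninf \<union> (\<Union>(p, q)\<in>I. N p q))"
    using AC_infinite_slope_negligible[OF g] AC_slope_gap_negligible[OF g]
    by (auto intro!: negligible_Un negligible_countable_Union simp: I_def N_def Ninf_def)
  have "g differentiable at x" if x: "x \<notin> Ninf \<union> (\<Union>(p, q)\<in>I. N p q)" for x
  proof -
    define Q where "Q t = (g t - g x) / (t - x)" for t
    have cont: "isCont g x" by (rule AC_loc_real_isCont[OF g])
    \<comment> \<open>Large quotients of \<open>g\<close> are positive quotients of \<open>g\<close>
      minus a linear function of slope \<open>k\<close>, which produce rising intervals around
      \<open>x\<close>.\<close>
    have up: "x \<in> fine_points (\<lambda>u v. k * (v - u) \<le> g v - g u)" if fr: "\<exists>\<^sub>F t in at x. k < Q t" for k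
    proof -
      have "\<forall>\<^sub>F t in at x. t \<noteq> x" by (simp add: eventually_at_filter)
      with fr have "\<exists>\<^sub>F t in at x. t \<noteq> x \<and> k < Q t" by (rule frequently_eventually_conj)
      then have "\<exists>\<^sub>F t in at x. ((g t - k * t) - (g x - k * x)) / (t - x) > 0"
        by (rule frequently_elim1) (simp add: Q_def field_simps divide_simps split: if_splits)
      then have "x \<in> fine_points (\<lambda>u v. g u - k * u < g v - k * v)"
        using cont by (intro frequently_slope_fine_points) (auto intro!: continuous_intros)
      then show ?thesis by (rule fine_points_mono) (simp add: algebra_simps)
    qed
    have down: "x \<in> fine_points (\<lambda>u v. g v - g u \<le> k * (v - u))" if fr: "\<exists>\<^sub>F t in at x. Q t < k" for k
    proof -
      have "\<forall>\<^sub>F t in at x. t \<noteq> x" by (simp add: eventually_at_filter)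
      with fr have "\<exists>\<^sub>F t in at x. t \<noteq> x \<and> Q t < k" by (rule frequently_eventually_conj)
      then have "\<exists>\<^sub>F t in at x. ((k * t - g t) - (k * x - g x)) / (t - x) > 0"
        by (rule frequently_elim1) (simp add: Q_def field_simps divide_simps split: if_splits)
      then have "x \<in> fine_points (\<lambda>u v. k * u - g u < k * v - g v)"
        using cont by (intro frequently_slope_fine_points) (auto intro!: continuous_intros)
      then show ?thesis by (rule fine_points_mono) (simp add: algebra_simps)
    qed
    obtain k :: nat where k: "x \<notin> fine_points (\<lambda>u v. real k * (v - u) \<le> \<bar>g v - g u\<bar>)"
      using x by (auto simp: Ninf_def)
    have "x \<notin> fine_points (\<lambda>u v. real k * (v - u) \<le> g v - g u)"
      using k by (auto intro: fine_points_mono)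
    then have ev_le: "\<forall>\<^sub>F t in at x. Q t \<le> k"
      using up[of k] by (auto simp: frequently_def not_less)
    have "x \<notin> fine_points (\<lambda>u v. g v - g u \<le> - real k * (v - u))"
      using k by (auto intro: fine_points_mono)
    then have ev_ge: "\<forall>\<^sub>F t in at x. - k \<le> Q t"
      using down[of "- k"] by (auto simp: frequently_def not_less)
    \<comment> \<open>\<open>S\<close> is the set of eventual lower bounds of \<open>Q\<close>, so
      its supremum is the lower limit.\<close>
    define S where "S = {p. \<forall>\<^sub>F t in at x. p \<le> Q t}"
    have S_ub: "p \<le> k" if "p \<in> S" for p
    proof -
      have "\<forall>\<^sub>F t in at x. p \<le> Q t" using that by (simp add: S_def)
      then have "\<forall>\<^sub>F t in at x. p \<le> real k" using ev_le by eventually_elim linarith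
      then show ?thesis by simp
    qed
    have S: "S \<noteq> {}" "bdd_above S" using ev_ge S_ub by (auto simp: S_def bdd_above_def)
    have "(Q \<longlongrightarrow> Sup S) (at x)"
    proof (rule order_tendstoI)
      fix a assume "a < Sup S"
      then obtain p where "p \<in> S" "a < p" using less_cSup_iff[OF S] by blast
      then show "\<forall>\<^sub>F t in at x. a < Q t" unfolding S_def by (auto elim!: eventually_mono)
    next
      fix a assume "Sup S < a"
      \<comment> \<open>Two rationals are needed above \<open>Sup S\<close>: \<open>Q\<close> is
        frequently below \<open>p\<close>, hence eventually at most \<open>q\<close>, and
        \<open>q\<close> leaves a strict margin to \<open>a\<close>.\<close>
      then obtain p where p: "p \<in> \<rat>" "Sup S < p" "p < a" using Rats_dense_in_real by blast
      then obtain q where q: "q \<in> \<rat>" "p < q" "q < a" using Rats_dense_in_real by blast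
      have "p \<notin> S" using cSup_upper[OF _ S(2)] p by force
      then have "x \<in> fine_points (\<lambda>u v. g v - g u \<le> p * (v - u))"
        using down[of p] by (auto simp: S_def frequently_def not_less)
      moreover have "x \<notin> N p q" using x p q by (auto simp: I_def)
      ultimately have "\<not> (\<exists>\<^sub>F t in at x. q < Q t)" using up[of q] by (auto simp: N_def)
      then have "\<forall>\<^sub>F t in at x. Q t \<le> q" by (simp add: frequently_def not_less)
      then show "\<forall>\<^sub>F t in at x. Q t < a" using q by (auto elim!: eventually_mono)
    qed
    then have "(g has_field_derivative Sup S) (at x)"
      unfolding has_field_derivative_iff Q_def .
    then show ?thesis using field_differentiable_def field_differentiable_imp_differentiable by blast
  qed
  then have "{x. \<not> g differentiable at x} \<subseteq> Ninf \<union> (\<Union>(p, q)\<in>I. N p q)" by blast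
  then show ?thesis using null negligible_subset by blast
qed

theorem AC_loc_differentiable_AE:
  assumes f: "AC_loc f"
  shows "AE x in lebesgue. f differentiable at x"
proof -
  have "\<bar>Re (f x) - Re (f y)\<bar> \<le> cmod (f x - f y)" "\<bar>Im (f x) - Im (f y)\<bar> \<le> cmod (f x - f y)" for x y
    using abs_Re_le_cmod[of "f x - f y"] abs_Im_le_cmod[of "f x - f y"] by simp_all
  then have AC: "AC_loc_real (\<lambda>x. Re (f x))" "AC_loc_real (\<lambda>x. Im (f x))"
    by (auto intro: AC_loc_imp_AC_loc_real[OF f])
  have "negligible ({x. \<not> (\<lambda>x. Re (f x)) differentiable at x} \<union>
      {x. \<not> (\<lambda>x. Im (f x)) differentiable at x})" (is "negligible ?N")
    by (rule negligible_Un[OF AC[THEN AC_loc_real_differentiable]])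
  then have "?N \<in> null_sets lebesgue" by (simp add: negligible_iff_null_sets)
  moreover have "f differentiable at x" if "x \<notin> ?N" for x
  proof -
    have "(\<lambda>x. Re (f x)) differentiable at x" "(\<lambda>x. Im (f x)) differentiable at x"
      using that by simp_all
    then obtain a b where "((\<lambda>x. Re (f x)) has_field_derivative a) (at x)"
      "((\<lambda>x. Im (f x)) has_field_derivative b) (at x)"
      by (elim real_differentiableE)
    then have "(f has_vector_derivative Complex a b) (at x)"
      by (simp add: has_vector_derivative_complex_iff)
    then show ?thesis by (rule differentiableI_vector)
  qed
  ultimately show ?thesis by (intro AE_I'[of ?N]) auto
qed


section \<open>Inhomogeneous Sturm--Liouville equations\<close>

definition glue :: "(real \<Rightarrow> complex) \<Rightarrow> (real \<Rightarrow> complex) \<Rightarrow> real \<Rightarrow> complex" where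
  "glue f g x = (if 0 \<le> x then f x else g x)"

text \<open>Common source of the closure of \<open>AC_loc\<close> under linear combinations,
  conjugation and gluing.\<close>

lemma AC_loc_dominated:
  assumes f: "AC_loc f" and g: "AC_loc g" and "C > 0"
    and h: "\<And>x y. cmod (h x - h y) \<le> C * (cmod (f x - f y) + cmod (g x - g y))"
  shows "AC_loc h"
  unfolding AC_loc_def AC_on_def
proof (intro allI impI)
  fix a b \<epsilon> :: real assume "\<epsilon> > 0"
  then have e: "\<epsilon> / (2 * C) > 0" using \<open>C > 0\<close> by simp
  obtain \<delta>1 where "\<delta>1 > 0" and \<delta>1: "\<forall>(n::nat) u v.
      (\<forall>i<n. a \<le> u i \<and> u i \<le> v i \<and> v i \<le> b) \<longrightarrow>
      (\<forall>i<n. \<forall>j<n. i \<noteq> j \<longrightarrow> {u i<..<v i} \<inter> {u j<..<v j} = {}) \<longrightarrow>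
      (\<Sum>i<n. v i - u i) < \<delta>1 \<longrightarrow> (\<Sum>i<n. cmod (f (v i) - f (u i))) < \<epsilon> / (2 * C)"
    using f[unfolded AC_loc_def AC_on_def, rule_format, of _ a b, OF e] by (elim exE conjE)
  obtain \<delta>2 where "\<delta>2 > 0" and \<delta>2: "\<forall>(n::nat) u v.
      (\<forall>i<n. a \<le> u i \<and> u i \<le> v i \<and> v i \<le> b) \<longrightarrow>
      (\<forall>i<n. \<forall>j<n. i \<noteq> j \<longrightarrow> {u i<..<v i} \<inter> {u j<..<v j} = {}) \<longrightarrow>
      (\<Sum>i<n. v i - u i) < \<delta>2 \<longrightarrow> (\<Sum>i<n. cmod (g (v i) - g (u i))) < \<epsilon> / (2 * C)"
    using g[unfolded AC_loc_def AC_on_def, rule_format, of _ a b, OF e] by (elim exE conjE)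
  show "\<exists>\<delta>>0. \<forall>(n::nat) u v.
      (\<forall>i<n. a \<le> u i \<and> u i \<le> v i \<and> v i \<le> b) \<longrightarrow>
      (\<forall>i<n. \<forall>j<n. i \<noteq> j \<longrightarrow> {u i<..<v i} \<inter> {u j<..<v j} = {}) \<longrightarrow>
      (\<Sum>i<n. v i - u i) < \<delta> \<longrightarrow> (\<Sum>i<n. cmod (h (v i) - h (u i))) < \<epsilon>"
  proof (intro exI[of _ "min \<delta>1 \<delta>2"] conjI allI impI)
    show "min \<delta>1 \<delta>2 > 0" using \<open>\<delta>1 > 0\<close> \<open>\<delta>2 > 0\<close> by simp
    fix n :: nat and u v
    assume *: "\<forall>i<n. a \<le> u i \<and> u i \<le> v i \<and> v i \<le> b"
      "\<forall>i<n. \<forall>j<n. i \<noteq> j \<longrightarrow> {u i<..<v i} \<inter> {u j<..<v j} = {}"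
      "(\<Sum>i<n. v i - u i) < min \<delta>1 \<delta>2"
    have "(\<Sum>i<n. cmod (h (v i) - h (u i))) \<le>
        (\<Sum>i<n. C * (cmod (f (v i) - f (u i)) + cmod (g (v i) - g (u i))))"
      by (intro sum_mono h)
    also have "\<dots> = C * ((\<Sum>i<n. cmod (f (v i) - f (u i))) + (\<Sum>i<n. cmod (g (v i) - g (u i))))"
      by (simp only: sum_distrib_left[symmetric] sum.distrib)
    also have "\<dots> < C * (\<epsilon> / (2 * C) + \<epsilon> / (2 * C))"
    proof (intro mult_strict_left_mono add_strict_mono \<open>C > 0\<close>)
      show "(\<Sum>i<n. cmod (f (v i) - f (u i))) < \<epsilon> / (2 * C)"
        using \<delta>1[THEN spec, THEN spec, THEN spec, of n u v] * by simp
      show "(\<Sum>i<n. cmod (g (v i) - g (u i))) < \<epsilon> / (2 * C)"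
        using \<delta>2[THEN spec, THEN spec, THEN spec, of n u v] * by simp
    qed
    also have "\<dots> = \<epsilon>" using \<open>C > 0\<close> by (simp add: field_simps)
    finally show "(\<Sum>i<n. cmod (h (v i) - h (u i))) < \<epsilon>" .
  qed
qed

lemma AC_loc_linear_combination:
  assumes "AC_loc f" "AC_loc g"
  shows "AC_loc (\<lambda>x. a * f x + b * g x)"
proof (rule AC_loc_dominated[OF assms])
  show "cmod a + cmod b + 1 > 0" by (simp add: add_nonneg_pos)
  fix x y
  have "a * f x + b * g x - (a * f y + b * g y) = a * (f x - f y) + b * (g x - g y)"
    by (simp add: algebra_simps)
  also have "cmod \<dots> \<le> cmod a * cmod (f x - f y) + cmod b * cmod (g x - g y)"
    by (metis norm_mult norm_triangle_ineq)
  also have "\<dots> \<le> (cmod a + cmod b + 1) * (cmod (f x - f y) + cmod (g x - g y))"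
    unfolding distrib_left by (intro add_mono mult_right_mono) auto
  finally show "cmod (a * f x + b * g x - (a * f y + b * g y)) \<le>
      (cmod a + cmod b + 1) * (cmod (f x - f y) + cmod (g x - g y))" .
qed

lemma AC_loc_cnj:
  assumes "AC_loc f"
  shows "AC_loc (\<lambda>x. cnj (f x))"
proof (rule AC_loc_dominated[OF assms assms, of 1])
  show "cmod (cnj (f x) - cnj (f y)) \<le> 1 * (cmod (f x - f y) + cmod (f x - f y))" for x y
    unfolding complex_cnj_diff[symmetric] complex_mod_cnj by simp
qed simp

text \<open>A nondecreasing map that does not expand distances sends non-overlapping intervals to
  non-overlapping intervals that are no longer. It is meant for \<open>max x 0\<close> and
  \<open>min x 0\<close>.\<close>

lemma AC_loc_compose:
  fixes \<phi> :: "real \<Rightarrow> real"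
  assumes f: "AC_loc f" and \<phi>: "\<And>x y. x \<le> y \<Longrightarrow> \<phi> x \<le> \<phi> y \<and> \<phi> y - \<phi> x \<le> y - x"
  shows "AC_loc (\<lambda>x. f (\<phi> x))"
  unfolding AC_loc_def AC_on_def
proof (intro allI impI)
  fix a b \<epsilon> :: real assume "\<epsilon> > 0"
  obtain \<delta> where "\<delta> > 0" and \<delta>: "\<forall>(n::nat) u v.
      (\<forall>i<n. \<phi> a \<le> u i \<and> u i \<le> v i \<and> v i \<le> \<phi> b) \<longrightarrow>
      (\<forall>i<n. \<forall>j<n. i \<noteq> j \<longrightarrow> {u i<..<v i} \<inter> {u j<..<v j} = {}) \<longrightarrow>
      (\<Sum>i<n. v i - u i) < \<delta> \<longrightarrow> (\<Sum>i<n. cmod (f (v i) - f (u i))) < \<epsilon>"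
    using f[unfolded AC_loc_def AC_on_def, rule_format, of _ "\<phi> a" "\<phi> b", OF \<open>\<epsilon> > 0\<close>]
    by (elim exE conjE)
  show "\<exists>\<delta>>0. \<forall>(n::nat) u v.
      (\<forall>i<n. a \<le> u i \<and> u i \<le> v i \<and> v i \<le> b) \<longrightarrow>
      (\<forall>i<n. \<forall>j<n. i \<noteq> j \<longrightarrow> {u i<..<v i} \<inter> {u j<..<v j} = {}) \<longrightarrow>
      (\<Sum>i<n. v i - u i) < \<delta> \<longrightarrow> (\<Sum>i<n. cmod (f (\<phi> (v i)) - f (\<phi> (u i)))) < \<epsilon>"
  proof (intro exI[of _ \<delta>] conjI allI impI \<open>\<delta> > 0\<close>)
    fix n :: nat and u v
    assume *: "\<forall>i<n. a \<le> u i \<and> u i \<le> v i \<and> v i \<le> b"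
      "\<forall>i<n. \<forall>j<n. i \<noteq> j \<longrightarrow> {u i<..<v i} \<inter> {u j<..<v j} = {}"
      "(\<Sum>i<n. v i - u i) < \<delta>"
    have "{\<phi> (u i)<..<\<phi> (v i)} \<inter> {\<phi> (u j)<..<\<phi> (v j)} = {}" if ij: "i < n" "j < n" "i \<noteq> j" for i j
    proof (rule ccontr)
      assume "\<not> ?thesis"
      then obtain t where "t \<in> {\<phi> (u i)<..<\<phi> (v i)} \<inter> {\<phi> (u j)<..<\<phi> (v j)}" by blast
      then have t: "\<phi> (u i) < t" "t < \<phi> (v i)" "\<phi> (u j) < t" "t < \<phi> (v j)" by auto
      have "u i < v j" "u j < v i" "u i < v i" "u j < v j"
        using t \<phi>[of "v j" "u i"] \<phi>[of "v i" "u j"] \<phi>[of "v i" "u i"] \<phi>[of "v j" "u j"]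
        by (meson leI less_trans not_less)+
      then have "max (u i) (u j) < min (v i) (v j)" by auto
      then obtain t' where "max (u i) (u j) < t'" "t' < min (v i) (v j)" using dense by blast
      then have "t' \<in> {u i<..<v i} \<inter> {u j<..<v j}" by auto
      then show False using *(2) ij by blast
    qed
    moreover have "(\<Sum>i<n. \<phi> (v i) - \<phi> (u i)) < \<delta>"
      using * \<phi> by (intro le_less_trans[OF sum_mono *(3)]) auto
    moreover have "\<phi> a \<le> \<phi> (u i) \<and> \<phi> (u i) \<le> \<phi> (v i) \<and> \<phi> (v i) \<le> \<phi> b" if "i < n" for i
      using *(1) that \<phi> by blast
    ultimately show "(\<Sum>i<n. cmod (f (\<phi> (v i)) - f (\<phi> (u i)))) < \<epsilon>"
      using \<delta>[THEN spec, THEN spec, THEN spec, of n "\<lambda>i. \<phi> (u i)" "\<lambda>i. \<phi> (v i)"] by blast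
  qed
qed

text \<open>The glued function is \<open>f (max x 0) + g (min x 0) - g 0\<close>.\<close>

lemma AC_loc_glue:
  assumes f: "AC_loc f" and g: "AC_loc g" and "f 0 = g 0"
  shows "AC_loc (glue f g)"
proof (rule AC_loc_dominated[of "\<lambda>x. f (max x 0)" "\<lambda>x. g (min x 0)" 1])
  show "AC_loc (\<lambda>x. f (max x 0))" by (rule AC_loc_compose[OF f]) auto
  show "AC_loc (\<lambda>x. g (min x 0))" by (rule AC_loc_compose[OF g]) auto
  have eq: "glue f g x = f (max x 0) + g (min x 0) - g 0" for x
    using \<open>f 0 = g 0\<close> by (auto simp: glue_def max_def min_def)
  fix x y
  have "glue f g x - glue f g y = (f (max x 0) - f (max y 0)) + (g (min x 0) - g (min y 0))"
    by (simp add: eq)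
  then show "cmod (glue f g x - glue f g y) \<le>
      1 * (cmod (f (max x 0) - f (max y 0)) + cmod (g (min x 0) - g (min y 0)))"
    by (metis mult_1 norm_triangle_ineq)
qed simp

section \<open>The equation with an arbitrary right-hand side\<close>

lemma ddx_eqI: "(f has_vector_derivative d) (at x) \<Longrightarrow> ddx f x = d"
  unfolding ddx_def by (rule vector_derivative_at)

lemma differentiable_has_ddx:
  "f differentiable at x \<Longrightarrow> (f has_vector_derivative ddx f x) (at x)"
  unfolding ddx_def by (simp add: vector_derivative_works)

text \<open>An unspecified right-hand side \<open>F\<close> makes it possible to superpose solutions
  with different spectral parameters, here \<open>z\<close> and \<open>cnj z\<close>.\<close>

definition sl_eq :: "(real \<Rightarrow> real) \<Rightarrow> (real \<Rightarrow> complex) \<Rightarrow> (real \<Rightarrow> complex) \<Rightarrow> bool" where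
  "sl_eq q y F \<longleftrightarrow> AC_loc_with_derivative y \<and>
     (AE x in lebesgue. - ddx (ddx y) x + of_real (q x) * y x = F x)"

lemma sl_solution_iff_sl_eq: "sl_solution q w z y \<longleftrightarrow> sl_eq q y (\<lambda>x. z * of_real (w x) * y x)"
  unfolding sl_solution_def sl_eq_def ..

text \<open>Almost everywhere differentiability of the absolutely continuous \<open>ddx y\<close>
  enters here: it makes \<open>ddx (ddx y)\<close> a genuine derivative almost everywhere.\<close>

lemma sl_eqD:
  assumes "sl_eq q y F"
  shows "AC_loc y" "(y has_vector_derivative ddx y x) (at x)" "AC_loc (ddx y)"
    and "AE x in lebesgue. (ddx y has_vector_derivative ddx (ddx y) x) (at x) \<and>
           - ddx (ddx y) x + of_real (q x) * y x = F x"
proof -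
  have *: "AC_loc y" "\<And>x. y differentiable at x" "AC_loc (ddx y)"
    "AE x in lebesgue. - ddx (ddx y) x + of_real (q x) * y x = F x"
    using assms by (auto simp: sl_eq_def AC_loc_with_derivative_def)
  show "AC_loc y" "(y has_vector_derivative ddx y x) (at x)" "AC_loc (ddx y)"
    using * by (auto intro: differentiable_has_ddx)
  show "AE x in lebesgue. (ddx y has_vector_derivative ddx (ddx y) x) (at x) \<and>
           - ddx (ddx y) x + of_real (q x) * y x = F x"
    using AC_loc_differentiable_AE[OF *(3)] *(4)
    by eventually_elim (auto intro: differentiable_has_ddx)
qed

lemma sl_eqI:
  assumes "AC_loc y" "\<And>x. (y has_vector_derivative y' x) (at x)" "AC_loc y'"
    and "AE x in lebesgue. (y' has_vector_derivative y'' x) (at x) \<and> - y'' x + of_real (q x) * y x = F x"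
  shows "sl_eq q y F"
proof -
  have dy: "ddx y = y'" using assms(2) by (intro ext ddx_eqI)
  have "AE x in lebesgue. - ddx (ddx y) x + of_real (q x) * y x = F x"
    using assms(4) unfolding dy by eventually_elim (auto simp: ddx_eqI)
  then show ?thesis
    using assms(1-3) dy unfolding sl_eq_def AC_loc_with_derivative_def
    by (auto intro: differentiableI_vector)
qed

lemma sl_eq_linear_combination:
  assumes f: "sl_eq q f F" and g: "sl_eq q g G"
  shows "sl_eq q (\<lambda>x. a * f x + b * g x) (\<lambda>x. a * F x + b * G x)"
    and "ddx (\<lambda>x. a * f x + b * g x) x = a * ddx f x + b * ddx g x"
proof -
  have d: "((\<lambda>x. a * f x + b * g x) has_vector_derivative a * ddx f x + b * ddx g x) (at x)" for x
    using sl_eqD(2)[OF f] sl_eqD(2)[OF g] by (auto intro!: derivative_eq_intros)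
  then show "ddx (\<lambda>x. a * f x + b * g x) x = a * ddx f x + b * ddx g x"
    by (rule ddx_eqI)
  show "sl_eq q (\<lambda>x. a * f x + b * g x) (\<lambda>x. a * F x + b * G x)"
  proof (rule sl_eqI[OF _ d, of "\<lambda>x. a * ddx (ddx f) x + b * ddx (ddx g) x"])
    show "AE x in lebesgue.
        ((\<lambda>x. a * ddx f x + b * ddx g x) has_vector_derivative a * ddx (ddx f) x + b * ddx (ddx g) x) (at x) \<and>
        - (a * ddx (ddx f) x + b * ddx (ddx g) x) + of_real (q x) * (a * f x + b * g x) = a * F x + b * G x"
      using sl_eqD(4)[OF f] sl_eqD(4)[OF g]
    proof eventually_elim
      case (elim x)
      have "a * F x + b * G x =
          a * (- ddx (ddx f) x + of_real (q x) * f x) + b * (- ddx (ddx g) x + of_real (q x) * g x)"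
        using elim by simp
      then show ?case using elim by (auto intro!: derivative_eq_intros simp: algebra_simps)
    qed
  qed (use sl_eqD[OF f] sl_eqD[OF g] in \<open>auto intro: AC_loc_linear_combination\<close>)
qed

text \<open>The coefficient \<open>q\<close> is real.\<close>

lemma sl_eq_cnj:
  assumes f: "sl_eq q f F"
  shows "sl_eq q (\<lambda>x. cnj (f x)) (\<lambda>x. cnj (F x))" and "ddx (\<lambda>x. cnj (f x)) x = cnj (ddx f x)"
proof -
  have d: "((\<lambda>x. cnj (f x)) has_vector_derivative cnj (ddx f x)) (at x)" for x
    using sl_eqD(2)[OF f] by (rule has_vector_derivative_cnj)
  then show "ddx (\<lambda>x. cnj (f x)) x = cnj (ddx f x)"
    by (rule ddx_eqI)
  show "sl_eq q (\<lambda>x. cnj (f x)) (\<lambda>x. cnj (F x))"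
  proof (rule sl_eqI[OF _ d, of "\<lambda>x. cnj (ddx (ddx f) x)"])
    show "AE x in lebesgue. ((\<lambda>x. cnj (ddx f x)) has_vector_derivative cnj (ddx (ddx f) x)) (at x) \<and>
        - cnj (ddx (ddx f) x) + of_real (q x) * cnj (f x) = cnj (F x)"
      using sl_eqD(4)[OF f]
    proof eventually_elim
      case (elim x)
      have "cnj (F x) = cnj (- ddx (ddx f) x + of_real (q x) * f x)" using elim by simp
      then show ?case using elim by (auto intro: has_vector_derivative_cnj)
    qed
  qed (use sl_eqD[OF f] in \<open>auto intro: AC_loc_cnj\<close>)
qed

lemma glue_has_vector_derivative:
  assumes f: "(f has_vector_derivative d) (at x)" and g: "(g has_vector_derivative d') (at x)"
    and "x = 0 \<Longrightarrow> f 0 = g 0 \<and> d = d'"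
  shows "(glue f g has_vector_derivative (if 0 \<le> x then d else d')) (at x)"
proof -
  consider "x > 0" | "x < 0" | "x = 0" by linarith
  then show ?thesis
  proof cases
    case 1
    have "(glue f g has_vector_derivative d) (at x)"
      by (rule has_vector_derivative_transform_within_open[OF f, of "{0<..}"]) (use 1 in \<open>auto simp: glue_def\<close>)
    then show ?thesis using 1 by simp
  next
    case 2
    have "(glue f g has_vector_derivative d') (at x)"
      by (rule has_vector_derivative_transform_within_open[OF g, of "{..<0}"]) (use 2 in \<open>auto simp: glue_def\<close>)
    then show ?thesis using 2 by simp
  next
    case 3
    have "(glue f g has_vector_derivative d) (at x within {0..})"
      by (rule has_vector_derivative_transform[OF _ _ has_vector_derivative_at_within[OF f]])
        (use 3 in \<open>auto simp: glue_def\<close>)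
    moreover have "(glue f g has_vector_derivative d) (at x within {..0})"
      by (rule has_vector_derivative_transform[OF _ _ has_vector_derivative_at_within[OF g, unfolded assms(3)[OF 3, THEN conjunct2, symmetric]]])
        (use 3 assms(3) in \<open>auto simp: glue_def\<close>)
    ultimately have "(glue f g has_vector_derivative d) (at x within ({0..} \<union> {..0}))"
      unfolding has_vector_derivative_def has_derivative_within by (auto intro: Lim_Un)
    moreover have "{0..} \<union> {..0} = (UNIV :: real set)" by auto
    ultimately show ?thesis using 3 by simp
  qed
qed

lemma sl_eq_glue:
  assumes f: "sl_eq q f F" and g: "sl_eq q g G" and "f 0 = g 0" "ddx f 0 = ddx g 0"
  shows "sl_eq q (glue f g) (glue F G)"
proof -
  have d: "(glue f g has_vector_derivative glue (ddx f) (ddx g) x) (at x)" for x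
    unfolding glue_def[of "ddx f"]
    using sl_eqD(2)[OF f] sl_eqD(2)[OF g] assms(3,4) by (intro glue_has_vector_derivative) auto
  show ?thesis
  proof (rule sl_eqI[OF _ d, of "glue (ddx (ddx f)) (ddx (ddx g))"])
    \<comment> \<open>The second derivatives of \<open>f\<close> and \<open>g\<close> may differ at
      0, so this point is discarded as a null set.\<close>
    have "AE x in lebesgue. x \<noteq> (0::real)"
      by (rule AE_I'[of "{0}"]) (auto simp: negligible_iff_null_sets[symmetric])
    then show "AE x in lebesgue.
        (glue (ddx f) (ddx g) has_vector_derivative glue (ddx (ddx f)) (ddx (ddx g)) x) (at x) \<and>
        - glue (ddx (ddx f)) (ddx (ddx g)) x + of_real (q x) * glue f g x = glue F G x"
      using sl_eqD(4)[OF f] sl_eqD(4)[OF g]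
    proof eventually_elim
      case (elim x)
      then show ?case
        using glue_has_vector_derivative[of "ddx f" "ddx (ddx f) x" x "ddx g" "ddx (ddx g) x"]
        by (auto simp: glue_def[of "ddx (ddx f)"] glue_def[of f] glue_def[of F])
    qed
  qed (use sl_eqD[OF f] sl_eqD[OF g] assms(3,4) in \<open>auto intro: AC_loc_glue\<close>)
qed


section \<open>Square-integrable functions and the resolvent bound\<close>

definition L2_sq :: "'a measure \<Rightarrow> ('a \<Rightarrow> complex) \<Rightarrow> real" where
  "L2_sq M f = (LINT x|M. (cmod (f x))\<^sup>2)"

lemma L2_sq_nonneg: "0 \<le> L2_sq M f"
  unfolding L2_sq_def by simp

lemma L2_norm_power2: "(L2_norm M f)\<^sup>2 = L2_sq M f"
  unfolding L2_norm_def L2_sq_def by simp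

lemma cmod_add_power2_le: "(cmod (a + b))\<^sup>2 \<le> 2 * (cmod a)\<^sup>2 + 2 * (cmod b)\<^sup>2"
proof -
  have "(cmod (a + b))\<^sup>2 \<le> (cmod a + cmod b)\<^sup>2"
    by (intro power_mono norm_triangle_ineq) simp
  also have "\<dots> \<le> 2 * (cmod a)\<^sup>2 + 2 * (cmod b)\<^sup>2"
    using zero_le_power2[of "cmod a - cmod b"] by (simp add: power2_eq_square algebra_simps)
  finally show ?thesis .
qed

lemma L2_dominated:
  assumes "f \<in> L2 M" "g \<in> L2 M" "h \<in> borel_measurable M"
    and "\<And>x. x \<in> space M \<Longrightarrow> (cmod (h x))\<^sup>2 \<le> C * (cmod (f x))\<^sup>2 + D * (cmod (g x))\<^sup>2"
  shows "h \<in> L2 M"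
proof -
  have "integrable M (\<lambda>x. C * (cmod (f x))\<^sup>2 + D * (cmod (g x))\<^sup>2)"
    using assms by (auto simp: L2_def)
  then have "integrable M (\<lambda>x. (cmod (h x))\<^sup>2)"
  proof (rule Bochner_Integration.integrable_bound)
    show "AE x in M. norm ((cmod (h x))\<^sup>2) \<le> norm (C * (cmod (f x))\<^sup>2 + D * (cmod (g x))\<^sup>2)"
      using assms(4) by (intro AE_I2) (auto intro: order_trans[OF _ abs_ge_self])
  qed (use assms(3) in simp)
  then show ?thesis using assms(3) by (simp add: L2_def)
qed

lemma L2_linear_combination:
  assumes "f \<in> L2 M" "g \<in> L2 M"
  shows "(\<lambda>x. a * f x + b * g x) \<in> L2 M"
proof (rule L2_dominated[OF assms, of _ "2 * (cmod a)\<^sup>2" "2 * (cmod b)\<^sup>2"])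
  show "(\<lambda>x. a * f x + b * g x) \<in> borel_measurable M" using assms by (auto simp: L2_def)
  show "(cmod (a * f x + b * g x))\<^sup>2 \<le> 2 * (cmod a)\<^sup>2 * (cmod (f x))\<^sup>2 + 2 * (cmod b)\<^sup>2 * (cmod (g x))\<^sup>2" for x
    using cmod_add_power2_le[of "a * f x" "b * g x"] by (simp add: norm_mult power_mult_distrib)
qed

lemma borel_measurable_cnj:
  assumes "f \<in> borel_measurable M"
  shows "(\<lambda>x. cnj (f x)) \<in> borel_measurable M"
  using borel_measurable_continuous_on[OF continuous_on_cnj[OF continuous_on_id] assms] by simp

lemma L2_cnj:
  assumes "f \<in> L2 M"
  shows "(\<lambda>x. cnj (f x)) \<in> L2 M"
  using assms by (auto simp: L2_def intro: borel_measurable_cnj)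

lemma L2_inner_integrable:
  assumes "f \<in> L2 M" "g \<in> L2 M"
  shows "integrable M (\<lambda>x. f x * cnj (g x))"
proof (rule Bochner_Integration.integrable_bound)
  show "integrable M (\<lambda>x. (cmod (f x))\<^sup>2 + (cmod (g x))\<^sup>2)" using assms by (auto simp: L2_def)
  show "(\<lambda>x. f x * cnj (g x)) \<in> borel_measurable M"
    using assms by (auto simp: L2_def intro!: borel_measurable_times borel_measurable_cnj)
  have "cmod a * cmod b \<le> (cmod a)\<^sup>2 + (cmod b)\<^sup>2" for a b
  proof -
    have "2 * (cmod a * cmod b) \<le> (cmod a)\<^sup>2 + (cmod b)\<^sup>2"
      using zero_le_power2[of "cmod a - cmod b"] by (simp add: power2_eq_square algebra_simps)
    moreover have "0 \<le> cmod a * cmod b" by simp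
    ultimately show ?thesis by linarith
  qed
  then show "AE x in M. norm (f x * cnj (g x)) \<le> norm ((cmod (f x))\<^sup>2 + (cmod (g x))\<^sup>2)"
    by (simp add: norm_mult)
qed

text \<open>By self-adjointness the inner product of \<open>g\<close> with \<open>f\<close> is real,
  so that of \<open>g - z f\<close> with \<open>f\<close> has imaginary part \<open>- Im z\<close>
  times the squared norm of \<open>f\<close>.\<close>

lemma self_adjoint_resolvent_bound:
  assumes T: "self_adjoint_operator M T" and fg: "(f, g) \<in> T" and "Im z \<noteq> 0"
  shows "(Im z)\<^sup>2 * L2_sq M f \<le> L2_sq M (\<lambda>x. g x + (- z) * f x)"
proof -
  have adj: "adjoint_operator M T = T" and lin: "linear_operator M T"
    using T by (auto simp: self_adjoint_operator_def)
  have f: "f \<in> L2 M" and g: "g \<in> L2 M" using lin fg by (auto simp: linear_operator_def)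
  define k where "k x = g x + (- z) * f x" for x
  have k: "k \<in> L2 M" unfolding k_def using L2_linear_combination[OF g f, of 1 "- z"] by simp
  have "(f, g) \<in> adjoint_operator M T" using fg adj by simp
  then have "L2_inner M g f = L2_inner M f g" using fg unfolding adjoint_operator_def by auto
  also have "L2_inner M f g = cnj (L2_inner M g f)"
    unfolding L2_inner_def Bochner_Integration.integral_cnj[symmetric] by (simp add: mult.commute)
  finally have real: "Im (L2_inner M g f) = 0"
    by (metis complex_cnj_cancel_iff cnj.sel(2) equal_neg_zero)
  have "L2_inner M k f = (LINT x|M. g x * cnj (f x) + (- z) * (f x * cnj (f x)))"
    unfolding L2_inner_def k_def by (simp add: algebra_simps)
  also have "\<dots> = L2_inner M g f + (- z) * (LINT x|M. f x * cnj (f x))"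
    unfolding L2_inner_def using L2_inner_integrable[OF g f] L2_inner_integrable[OF f f] by simp
  also have "(LINT x|M. f x * cnj (f x)) = of_real (L2_sq M f)"
    unfolding L2_sq_def integral_complex_of_real[symmetric]
    by (simp add: complex_norm_square[symmetric])
  finally have "Im (L2_inner M k f) = - Im z * L2_sq M f" using real by simp
  then have "\<bar>Im z\<bar> * L2_sq M f = \<bar>Im (L2_inner M k f)\<bar>"
    using L2_sq_nonneg[of M f] by (simp add: abs_mult)
  also have "\<dots> \<le> cmod (L2_inner M k f)" by (rule abs_Im_le_cmod)
  also have "\<dots> \<le> (LINT x|M. cmod (k x * cnj (f x)))"
    unfolding L2_inner_def by (rule integral_norm_bound)
  \<comment> \<open>A weighted inequality of arithmetic and geometric means takes the place of
    Cauchy-Schwarz. The weight \<open>\<bar>Im z\<bar>\<close> makes the last term half of the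
    left-hand side, and the constant comes out as 1.\<close>
  also have "\<dots> \<le> (LINT x|M. (cmod (k x))\<^sup>2 / (2 * \<bar>Im z\<bar>) + \<bar>Im z\<bar> / 2 * (cmod (f x))\<^sup>2)"
  proof (rule integral_mono)
    show "integrable M (\<lambda>x. cmod (k x * cnj (f x)))"
      using L2_inner_integrable[OF k f] by (rule integrable_norm)
    show "integrable M (\<lambda>x. (cmod (k x))\<^sup>2 / (2 * \<bar>Im z\<bar>) + \<bar>Im z\<bar> / 2 * (cmod (f x))\<^sup>2)"
      using f k by (auto simp: L2_def)
    fix x
    have "0 \<le> (cmod (k x) - \<bar>Im z\<bar> * cmod (f x))\<^sup>2 / (2 * \<bar>Im z\<bar>)" by simp
    also have "\<dots> = (cmod (k x))\<^sup>2 / (2 * \<bar>Im z\<bar>) + \<bar>Im z\<bar> / 2 * (cmod (f x))\<^sup>2 - cmod (k x) * cmod (f x)"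
      using \<open>Im z \<noteq> 0\<close> by (simp add: field_simps power2_eq_square)
    finally show "cmod (k x * cnj (f x)) \<le> (cmod (k x))\<^sup>2 / (2 * \<bar>Im z\<bar>) + \<bar>Im z\<bar> / 2 * (cmod (f x))\<^sup>2"
      by (simp add: norm_mult)
  qed
  also have "\<dots> = L2_sq M k / (2 * \<bar>Im z\<bar>) + \<bar>Im z\<bar> / 2 * L2_sq M f"
    unfolding L2_sq_def using f k by (auto simp: L2_def)
  finally have "\<bar>Im z\<bar> / 2 * L2_sq M f \<le> L2_sq M k / (2 * \<bar>Im z\<bar>)" by simp
  then have "\<bar>Im z\<bar> * \<bar>Im z\<bar> * L2_sq M f \<le> L2_sq M k"
    using \<open>Im z \<noteq> 0\<close> by (simp add: field_simps)
  moreover have "k = (\<lambda>x. g x + (- z) * f x)" by (rule ext) (simp add: k_def)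
  ultimately show ?thesis by (simp add: power2_eq_square)
qed

lemma bounded_operator_L2_sq:
  assumes "bounded_operator M S"
  obtains C where "C > 0" "\<And>f g. (f, g) \<in> S \<Longrightarrow> L2_sq M g \<le> C * L2_sq M f"
proof -
  obtain C where C: "\<And>f g. (f, g) \<in> S \<Longrightarrow> L2_norm M g \<le> C * L2_norm M f"
    using assms unfolding bounded_operator_def by blast
  \<comment> \<open>\<open>bounded_operator\<close> does not fix the sign of \<open>C\<close>;
    \<open>C\<^sup>2 + 1\<close> is positive in any case.\<close>
  have "L2_sq M g \<le> (C\<^sup>2 + 1) * L2_sq M f" if "(f, g) \<in> S" for f g
  proof -
    have "(L2_norm M g)\<^sup>2 \<le> (C * L2_norm M f)\<^sup>2"
      by (intro power_mono C that) (simp add: L2_norm_def)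
    then have "L2_sq M g \<le> C\<^sup>2 * L2_sq M f" by (simp add: power_mult_distrib L2_norm_power2)
    then show ?thesis using L2_sq_nonneg[of M f] by (simp add: distrib_right)
  qed
  moreover have "C\<^sup>2 + 1 > 0" by (simp add: add_nonneg_pos)
  ultimately show ?thesis using that by blast
qed

text \<open>The squared form of linear growth of the resolvent near the real axis, written as a
  lower bound for \<open>T - z\<close>, which makes sense before anything is known about the range
  of \<open>T - z\<close>.\<close>

definition resolvent_bound :: "'a measure \<Rightarrow> 'a operator \<Rightarrow> real \<Rightarrow> bool" where
  "resolvent_bound M T C \<longleftrightarrow> (\<forall>f g z. (f, g) \<in> T \<longrightarrow> Im z \<noteq> 0 \<longrightarrow>
     (Im z)\<^sup>2 * L2_sq M f \<le> C * L2_sq M (\<lambda>x. g x + (- z) * f x))"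

text \<open>The bound for the self-adjoint operator is carried over by \<open>S\<close>, applied to
  \<open>(T - z) f\<close>, and by its inverse, applied to the image of \<open>f\<close>. The
  constant is the product of the squared bounds of the two.\<close>

lemma similar_to_self_adjoint_resolvent_bound:
  assumes "similar_to_self_adjoint M T" and TL2: "T \<subseteq> L2 M \<times> L2 M"
  obtains C where "resolvent_bound M T C"
proof -
  obtain T' S where T': "self_adjoint_operator M T'" and S: "bounded_operator M S"
    and S': "bounded_operator M (S\<inverse>)" and eq: "T' = S\<inverse> O T O S"
    using assms by (auto simp: similar_to_self_adjoint_def similar_operators_def)
  obtain C1 where C1: "C1 > 0" "\<And>f g. (f, g) \<in> S \<Longrightarrow> L2_sq M g \<le> C1 * L2_sq M f"
    using bounded_operator_L2_sq[OF S] by blast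
  obtain C2 where C2: "C2 > 0" "\<And>f g. (f, g) \<in> S\<inverse> \<Longrightarrow> L2_sq M g \<le> C2 * L2_sq M f"
    using bounded_operator_L2_sq[OF S'] by blast
  have "(Im z)\<^sup>2 * L2_sq M f \<le> (C2 * C1) * L2_sq M (\<lambda>x. g x + (- z) * f x)"
    if fg: "(f, g) \<in> T" and "Im z \<noteq> 0" for f g z
  proof -
    have "f \<in> Domain S" "g \<in> Domain S"
      using fg TL2 S by (auto simp: bounded_operator_def)
    then obtain f' g' where fS: "(f, f') \<in> S" and gS: "(g, g') \<in> S" by blast
    have T'fg: "(f', g') \<in> T'" unfolding eq using fg fS gS by blast
    have lin: "linear_operator M S" using S by (simp add: bounded_operator_def)
    then have "((\<lambda>x. (- z) * f x), (\<lambda>x. (- z) * f' x)) \<in> S"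
      using fS unfolding linear_operator_def by blast
    then have kS: "((\<lambda>x. g x + (- z) * f x), (\<lambda>x. g' x + (- z) * f' x)) \<in> S"
      using gS lin unfolding linear_operator_def by blast
    have "(Im z)\<^sup>2 * L2_sq M f \<le> (Im z)\<^sup>2 * (C2 * L2_sq M f')"
      using C2(2)[of f' f] fS by (intro mult_left_mono) auto
    also have "\<dots> = C2 * ((Im z)\<^sup>2 * L2_sq M f')" by simp
    also have "\<dots> \<le> C2 * L2_sq M (\<lambda>x. g' x + (- z) * f' x)"
      using self_adjoint_resolvent_bound[OF T' T'fg \<open>Im z \<noteq> 0\<close>] C2(1) by (intro mult_left_mono) auto
    also have "\<dots> \<le> C2 * (C1 * L2_sq M (\<lambda>x. g x + (- z) * f x))"
      using C1(2)[OF kS] C2(1) by (intro mult_left_mono) auto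
    finally show ?thesis by simp
  qed
  then have "resolvent_bound M T (C2 * C1)" unfolding resolvent_bound_def by blast
  then show ?thesis by (rule that)
qed

lemma L1_loc_borel_measurable:
  assumes "L1_loc r"
  shows "r \<in> borel_measurable lebesgue"
proof (rule borel_measurable_LIMSEQ_real)
  show "(\<lambda>n. indicator {- real n..real n} x *\<^sub>R r x) \<longlonglongrightarrow> r x" for x
  proof (rule tendsto_eventually)
    obtain N :: nat where "\<bar>x\<bar> \<le> N" using real_arch_simple by blast
    then show "\<forall>\<^sub>F n in sequentially. indicator {- real n..real n} x *\<^sub>R r x = r x"
      unfolding eventually_sequentially by (intro exI[of _ N]) (auto simp: indicator_def)
  qed
  show "(\<lambda>x. indicator {- real n..real n} x *\<^sub>R r x) \<in> borel_measurable lebesgue" for n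
    using assms unfolding L1_loc_def set_integrable_def by blast
qed

lemma AE_lebesgue_nonzero: "AE x in lebesgue. x \<noteq> (0::real)"
  by (rule AE_I'[of "{0}"]) (auto simp: negligible_iff_null_sets[symmetric])


section \<open>The weighted space and glued solutions\<close>

locale sl_weight =
  fixes r :: "real \<Rightarrow> real"
  assumes L1_r: "L1_loc r" and sign_r: "\<And>x. x \<noteq> 0 \<Longrightarrow> x * r x > 0"
begin

abbreviation "W \<equiv> weighted_measure r"

lemma sets_W: "sets W = sets lebesgue" and space_W: "space W = UNIV"
  by (simp_all add: weighted_measure_def)

lemma borel_measurable_W: "borel_measurable W = (borel_measurable lebesgue :: (real \<Rightarrow> 'b::topological_space) set)"
  by (rule measurable_cong_sets) (simp_all add: sets_W)

text \<open>The weight can vanish only at 0, so both measures have the same null sets.\<close>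

lemma AE_W: "(AE x in W. P x) \<longleftrightarrow> (AE x in lebesgue. P x)"
proof -
  have [measurable]: "r \<in> borel_measurable lebesgue" by (rule L1_loc_borel_measurable[OF L1_r])
  have "(AE x in W. P x) \<longleftrightarrow> (AE x in lebesgue. 0 < ennreal \<bar>r x\<bar> \<longrightarrow> P x)"
    unfolding weighted_measure_def by (rule AE_density) measurable
  also have "\<dots> \<longleftrightarrow> (AE x in lebesgue. P x)"
  proof
    assume "AE x in lebesgue. 0 < ennreal \<bar>r x\<bar> \<longrightarrow> P x"
    then show "AE x in lebesgue. P x"
      using AE_lebesgue_nonzero
    proof eventually_elim
      case (elim x)
      then show ?case using sign_r[of x] by auto
    qed
  next
    assume "AE x in lebesgue. P x"
    then show "AE x in lebesgue. 0 < ennreal \<bar>r x\<bar> \<longrightarrow> P x" by eventually_elim simp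
  qed
  finally show ?thesis .
qed

lemma L2_W_cong_AE:
  assumes f: "f \<in> L2 W" and "AE x in lebesgue. f x = g x"
  shows "g \<in> L2 W"
proof -
  have g: "g \<in> borel_measurable W"
    using f borel_measurable_AE[OF _ assms(2)] by (auto simp: L2_def borel_measurable_W)
  moreover have "integrable W (\<lambda>x. (cmod (f x))\<^sup>2) \<longleftrightarrow> integrable W (\<lambda>x. (cmod (g x))\<^sup>2)"
  proof (rule integrable_cong_AE)
    show "AE x in W. (cmod (f x))\<^sup>2 = (cmod (g x))\<^sup>2"
      unfolding AE_W using assms(2) by eventually_elim simp
  qed (use f g in \<open>auto simp: L2_def\<close>)
  ultimately show ?thesis using f by (simp add: L2_def)
qed

lemma A_operatorI:
  assumes h: "h \<in> L2 W" and g: "g \<in> L2 W" and eq: "sl_eq q h (\<lambda>x. of_real (r x) * g x)"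
  shows "(h, g) \<in> A_operator q r"
proof -
  have ode: "AE x in lebesgue. - ddx (ddx h) x + of_real (q x) * h x = of_real (r x) * g x"
    using eq by (simp add: sl_eq_def)
  \<comment> \<open>The domain is defined through the expression with weight
    \<open>\<bar>r x\<bar>\<close>. Since \<open>A = J L\<close> and \<open>J\<close> is its own
    inverse, that expression gives \<open>(sgn x) g\<close> almost everywhere.\<close>
  define g' where "g' x = (if x \<in> {0..} then g x else - g x)" for x
  have "g' \<in> L2 W"
  proof (rule L2_dominated[OF g g, of _ 1 0])
    show "g' \<in> borel_measurable W"
      unfolding g'_def using g by (intro measurable_If_set) (auto simp: L2_def sets_W space_W)
  qed (simp add: g'_def)
  moreover have "AE x in lebesgue. g' x = sl_expr q (\<lambda>x. \<bar>r x\<bar>) h x"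
    using ode AE_lebesgue_nonzero
  proof eventually_elim
    case (elim x)
    have "r x \<noteq> 0" "0 \<le> x \<longleftrightarrow> 0 \<le> r x"
      using sign_r[OF elim(2)] by (auto simp: zero_less_mult_iff)
    then show ?case unfolding sl_expr_def elim(1) by (simp add: g'_def abs_if)
  qed
  ultimately have "sl_expr q (\<lambda>x. \<bar>r x\<bar>) h \<in> L2 W" by (rule L2_W_cong_AE)
  then have "h \<in> sl_domain q r" using h eq by (simp add: sl_domain_def sl_eq_def)
  moreover have "AE x in lebesgue. g x = sl_expr q r h x"
    using ode AE_lebesgue_nonzero
  proof eventually_elim
    case (elim x)
    then show ?case unfolding sl_expr_def elim(1) using sign_r[OF elim(2)] by auto
  qed
  ultimately show ?thesis
    using h g unfolding A_operator_def sl_operator_def ae_eq_def AE_W by auto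
qed

lemma glue_L2:
  assumes f: "f \<in> L2 (restrict_space W {0..})" and g: "g \<in> L2 (restrict_space W {..0})"
  shows "glue f g \<in> L2 W"
proof -
  have sets: "{0..} \<inter> space W \<in> sets W" "{..0} \<inter> space W \<in> sets W" by (auto simp: sets_W space_W)
  define F where "F x = indicator {0..} x *\<^sub>R f x" for x
  define G where "G x = indicator {..0} x *\<^sub>R g x" for x
  have sq: "(cmod (indicator S x *\<^sub>R h x))\<^sup>2 = indicator S x *\<^sub>R (cmod (h x))\<^sup>2" for S h and x :: real
    by (simp add: indicator_def)
  have F: "F \<in> L2 W" using f sets
    unfolding F_def L2_def mem_Collect_eq sq
    by (simp add: borel_measurable_restrict_space_iff integrable_restrict_space)
  have G: "G \<in> L2 W" using g sets
    unfolding G_def L2_def mem_Collect_eq sq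
    by (simp add: borel_measurable_restrict_space_iff integrable_restrict_space)
  have "(\<lambda>x. if x \<in> {0..} then F x else G x) \<in> borel_measurable W"
    using F G by (intro measurable_If_set) (auto simp: L2_def sets_W space_W)
  moreover have "(\<lambda>x. if x \<in> {0..} then F x else G x) = glue f g"
    by (auto simp: glue_def F_def G_def)
  ultimately have meas: "glue f g \<in> borel_measurable W" by simp
  show ?thesis
    by (rule L2_dominated[OF F G meas, of 1 1]) (auto simp: glue_def F_def G_def)
qed

text \<open>On either side the terms with \<open>a\<close> and \<open>b\<close> solve the equation
  with weight \<open>r\<close> and parameter \<open>z\<close>, so \<open>A - z\<close> annihilates
  them; their conjugates, with coefficients \<open>a'\<close> and \<open>b'\<close>, have parameter
  \<open>cnj z\<close> and are multiplied by \<open>cnj z - z\<close>. The squared modulus of this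
  factor is \<open>4 * (Im z)\<^sup>2\<close>, which cancels against the resolvent bound, so the
  estimate does not depend on \<open>z\<close>. The matching conditions make \<open>h\<close> an
  element of the domain.\<close>

lemma glued_solution_bound:
  assumes C: "resolvent_bound W (A_operator q r) C"
    and z: "Im z \<noteq> 0"
    and P: "sl_eq q P (\<lambda>x. z * of_real \<bar>r x\<bar> * P x)" "P \<in> L2 (restrict_space W {0..})"
    and N: "sl_eq q N (\<lambda>x. - z * of_real \<bar>r x\<bar> * N x)" "N \<in> L2 (restrict_space W {..0})"
    and match: "a * P 0 + a' * cnj (P 0) = b * N 0 + b' * cnj (N 0)"
      "a * ddx P 0 + a' * cnj (ddx P 0) = b * ddx N 0 + b' * cnj (ddx N 0)"
  defines "h \<equiv> glue (\<lambda>x. a * P x + a' * cnj (P x)) (\<lambda>x. b * N x + b' * cnj (N x))"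
  shows "h \<in> L2 W" "L2_sq W h \<le> 4 * C * L2_sq W (glue (\<lambda>x. a' * P x) (\<lambda>x. b' * N x))"
proof -
  \<comment> \<open>This is \<open>A h\<close>: multiplication by \<open>z\<close> or
    \<open>cnj z\<close> term by term.\<close>
  define g where "g = glue (\<lambda>x. a * z * P x + a' * cnj z * cnj (P x)) (\<lambda>x. b * z * N x + b' * cnj z * cnj (N x))"
  show h: "h \<in> L2 W"
    unfolding h_def using P(2) N(2) by (intro glue_L2 L2_linear_combination L2_cnj)
  have g: "g \<in> L2 W"
    unfolding g_def using P(2) N(2) by (intro glue_L2 L2_linear_combination L2_cnj)
  have "sl_eq q h (glue (\<lambda>x. a * (z * of_real \<bar>r x\<bar> * P x) + a' * cnj (z * of_real \<bar>r x\<bar> * P x))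
      (\<lambda>x. b * (- z * of_real \<bar>r x\<bar> * N x) + b' * cnj (- z * of_real \<bar>r x\<bar> * N x)))"
    unfolding h_def
  proof (rule sl_eq_glue)
    show "sl_eq q (\<lambda>x. a * P x + a' * cnj (P x))
        (\<lambda>x. a * (z * of_real \<bar>r x\<bar> * P x) + a' * cnj (z * of_real \<bar>r x\<bar> * P x))"
      by (rule sl_eq_linear_combination(1)[OF P(1) sl_eq_cnj(1)[OF P(1)]])
    show "sl_eq q (\<lambda>x. b * N x + b' * cnj (N x))
        (\<lambda>x. b * (- z * of_real \<bar>r x\<bar> * N x) + b' * cnj (- z * of_real \<bar>r x\<bar> * N x))"
      by (rule sl_eq_linear_combination(1)[OF N(1) sl_eq_cnj(1)[OF N(1)]])
    show "ddx (\<lambda>x. a * P x + a' * cnj (P x)) 0 = ddx (\<lambda>x. b * N x + b' * cnj (N x)) 0"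
      unfolding sl_eq_linear_combination(2)[OF P(1) sl_eq_cnj(1)[OF P(1)]]
        sl_eq_linear_combination(2)[OF N(1) sl_eq_cnj(1)[OF N(1)]]
        sl_eq_cnj(2)[OF P(1)] sl_eq_cnj(2)[OF N(1)] by (rule match)
  qed (rule match)
  \<comment> \<open>On the left \<open>\<bar>r x\<bar> = - r x\<close>, so the parameter
    \<open>- z\<close> for the weight \<open>\<bar>r x\<bar>\<close> is \<open>z\<close> for
    \<open>r\<close>.\<close>
  moreover have "glue (\<lambda>x. a * (z * of_real \<bar>r x\<bar> * P x) + a' * cnj (z * of_real \<bar>r x\<bar> * P x))
      (\<lambda>x. b * (- z * of_real \<bar>r x\<bar> * N x) + b' * cnj (- z * of_real \<bar>r x\<bar> * N x)) x = of_real (r x) * g x"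
    if "x \<noteq> 0" for x
    using sign_r[OF that] by (auto simp: glue_def g_def zero_less_mult_iff algebra_simps)
  ultimately have "sl_eq q h (\<lambda>x. of_real (r x) * g x)"
    using AE_lebesgue_nonzero unfolding sl_eq_def by (auto elim!: eventually_elim2)
  then have "(h, g) \<in> A_operator q r" by (rule A_operatorI[OF h g])
  then have "(Im z)\<^sup>2 * L2_sq W h \<le> C * L2_sq W (\<lambda>x. g x + (- z) * h x)"
    using C z unfolding resolvent_bound_def by blast
  also have "L2_sq W (\<lambda>x. g x + (- z) * h x) =
      4 * (Im z)\<^sup>2 * L2_sq W (glue (\<lambda>x. a' * P x) (\<lambda>x. b' * N x))"
  proof -
    have "g x + (- z) * h x = (cnj z - z) * glue (\<lambda>x. a' * cnj (P x)) (\<lambda>x. b' * cnj (N x)) x" for x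
      by (simp add: g_def h_def glue_def algebra_simps)
    moreover have "(cmod (cnj z - z))\<^sup>2 = 4 * (Im z)\<^sup>2"
      unfolding cmod_power2 by (simp add: power2_eq_square)
    moreover have "cmod (glue (\<lambda>x. a' * cnj (P x)) (\<lambda>x. b' * cnj (N x)) x) =
        cmod (glue (\<lambda>x. a' * P x) (\<lambda>x. b' * N x) x)" for x
      by (simp add: glue_def norm_mult)
    ultimately show ?thesis unfolding L2_sq_def by (simp add: norm_mult power_mult_distrib)
  qed
  finally have "(Im z)\<^sup>2 * L2_sq W h \<le> (Im z)\<^sup>2 * (4 * C * L2_sq W (glue (\<lambda>x. a' * P x) (\<lambda>x. b' * N x)))"
    by (simp add: mult_ac)
  then show "L2_sq W h \<le> 4 * C * L2_sq W (glue (\<lambda>x. a' * P x) (\<lambda>x. b' * N x))"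
    using z by (simp add: mult_le_cancel_left_pos)
qed

lemma L2_sq_W_eq_0_imp:
  assumes "f \<in> L2 W" "L2_sq W f = 0"
  shows "AE x in lebesgue. f x = 0"
proof -
  have "AE x in W. (cmod (f x))\<^sup>2 = 0"
    using assms unfolding L2_sq_def by (subst (asm) integral_nonneg_eq_0_iff_AE) (auto simp: L2_def)
  then show ?thesis by (simp add: AE_W)
qed

text \<open>The pointwise hypothesis comes from writing \<open>b * f\<close> as \<open>h\<close>
  minus a function with the modulus of \<open>f\<close>. It is integrated and divided by the
  positive \<open>L2_sq W f\<close>.\<close>

lemma coefficient_bound:
  assumes f: "f \<in> L2 W" and h: "h \<in> L2 W" and le: "L2_sq W h \<le> K * L2_sq W f" and "L2_sq W f > 0"
    and pw: "\<And>x. (cmod (b * f x))\<^sup>2 \<le> 2 * (cmod (h x))\<^sup>2 + 2 * (cmod (f x))\<^sup>2"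
  shows "(cmod b)\<^sup>2 \<le> 2 * K + 2"
proof -
  have "(cmod b)\<^sup>2 * L2_sq W f = (LINT x|W. (cmod (b * f x))\<^sup>2)"
    unfolding L2_sq_def by (simp add: norm_mult power_mult_distrib)
  also have "\<dots> \<le> (LINT x|W. 2 * (cmod (h x))\<^sup>2 + 2 * (cmod (f x))\<^sup>2)"
    using f h by (intro integral_mono pw) (auto simp: L2_def norm_mult power_mult_distrib)
  also have "\<dots> = 2 * L2_sq W h + 2 * L2_sq W f"
    unfolding L2_sq_def using f h by (simp add: L2_def)
  also have "\<dots> \<le> (2 * K + 2) * L2_sq W f" using le by (simp add: algebra_simps)
  finally show ?thesis using \<open>L2_sq W f > 0\<close> by simp
qed

end

section \<open>Nonvanishing of the solutions near 0\<close>

lemma eventually_nonzero_at_simple_zero: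
  fixes f :: "real \<Rightarrow> complex"
  assumes f: "(f has_vector_derivative 1) (at 0)"
  obtains d where "d > 0" "\<And>x. x \<noteq> 0 \<Longrightarrow> \<bar>x\<bar> < d \<Longrightarrow> f x \<noteq> 0"
\<comment> \<open>At a zero the first-order expansion with slope 1 dominates the error, for which
  any factor below 1 would do; otherwise continuity suffices.\<close>
proof (cases "f 0 = 0")
  case True
  have "\<forall>e>0. \<exists>d>0. \<forall>y. norm (y - 0) < d \<longrightarrow> norm (f y - f 0 - (y - 0) *\<^sub>R 1) \<le> e * norm (y - 0)"
    using f unfolding has_vector_derivative_def has_derivative_at_alt by blast
  then have "\<exists>d>0. \<forall>y. norm (y - 0) < d \<longrightarrow> norm (f y - f 0 - (y - 0) *\<^sub>R 1) \<le> 1 / 2 * norm (y - 0)"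
    by (elim allE[of _ "1 / 2"]) simp
  then obtain d where d: "d > 0" "\<And>y. \<bar>y\<bar> < d \<Longrightarrow> norm (f y - of_real y) \<le> 1 / 2 * \<bar>y\<bar>"
    using True by (auto simp: scaleR_conv_of_real)
  have "f x \<noteq> 0" if "x \<noteq> 0" "\<bar>x\<bar> < d" for x
    using d(2)[OF that(2)] that(1) by auto
  then show ?thesis using that d(1) by blast
next
  case False
  have "isCont f 0" using f has_vector_derivative_continuous by blast
  then have "\<forall>\<^sub>F x in at 0. f x \<noteq> 0"
    using False unfolding isCont_def by (rule tendsto_imp_eventually_ne)
  then show ?thesis using that unfolding eventually_at by (auto simp: dist_real_def)
qed

text \<open>Nonempty open sets are not null sets. Weyl solutions, normalised to have derivative 1 at
  0, thus have positive norm on their half-lines.\<close>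

lemma not_AE_zero_half_line:
  fixes f :: "real \<Rightarrow> complex"
  assumes f: "(f has_vector_derivative 1) (at 0)"
  shows "\<not> (AE x in lebesgue. 0 < x \<longrightarrow> f x = 0)" "\<not> (AE x in lebesgue. x < 0 \<longrightarrow> f x = 0)"
proof -
  obtain d where d: "d > 0" "\<And>x. x \<noteq> 0 \<Longrightarrow> \<bar>x\<bar> < d \<Longrightarrow> f x \<noteq> 0"
    using eventually_nonzero_at_simple_zero[OF f] by blast
  have *: False if "AE x in lebesgue. x \<notin> S" "open S" "S \<noteq> {}" for S :: "real set"
  proof -
    have "S \<in> null_sets lebesgue" using that by (subst AE_iff_null_sets) auto
    then show False using that open_not_negligible by (auto simp: negligible_iff_null_sets)
  qed
  show "\<not> (AE x in lebesgue. 0 < x \<longrightarrow> f x = 0)"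
  proof
    assume "AE x in lebesgue. 0 < x \<longrightarrow> f x = 0"
    then have "AE x in lebesgue. x \<notin> {0<..<d}" by eventually_elim (use d(2) in force)
    then show False using *[of "{0<..<d}"] d(1) by simp
  qed
  show "\<not> (AE x in lebesgue. x < 0 \<longrightarrow> f x = 0)"
  proof
    assume "AE x in lebesgue. x < 0 \<longrightarrow> f x = 0"
    then have "AE x in lebesgue. x \<notin> {- d<..<0}" by eventually_elim (use d(2) in force)
    then show False using *[of "{- d<..<0}"] d(1) by simp
  qed
qed

section \<open>Bounds for the Weyl coefficients\<close>

context sl_weight
begin

text \<open>\<open>\<mu>\<close> and \<open>\<nu>\<close> stand for the values of the two
  coefficients at \<open>z\<close>. The constant arises from \<open>4 * C\<close> in
  \<open>glued_solution_bound\<close>, which \<open>coefficient_bound\<close> turns into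
  \<open>8 * C + 2\<close>, and from the summand 1 in \<open>1 + a\<close> and \<open>1 + b\<close>.
  The factor 2 in \<open>\<xi> - cnj \<xi> = 2 i Im \<xi>\<close> is given away.\<close>

lemma Weyl_coefficient_bounds:
  assumes C: "resolvent_bound W (A_operator q r) C"
    and z: "Im z \<noteq> 0"
    and P: "sl_eq q P (\<lambda>x. z * of_real \<bar>r x\<bar> * P x)" "P \<in> L2 (restrict_space W {0..})"
    and N: "sl_eq q N (\<lambda>x. - z * of_real \<bar>r x\<bar> * N x)" "N \<in> L2 (restrict_space W {..0})"
    and init: "P 0 = - \<mu>" "ddx P 0 = 1" "N 0 = - \<nu>" "ddx N 0 = 1"
  shows "\<mu> \<noteq> \<nu>" "cmod (of_real (Im \<mu>) / (\<mu> - \<nu>)) \<le> 1 + sqrt (8 * C + 2)"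
    "cmod (of_real (Im \<nu>) / (\<mu> - \<nu>)) \<le> 1 + sqrt (8 * C + 2)"
proof -
  note bound = glued_solution_bound[OF C z P N, unfolded init]
  have zero: "(\<lambda>x. 0) \<in> L2 M" for M :: "real measure" by (simp add: L2_def)
  define p where "p = glue P (\<lambda>x. 0)"
  define n where "n = glue (\<lambda>x. 0) N"
  have p: "p \<in> L2 W" unfolding p_def by (intro glue_L2 P zero)
  have n: "n \<in> L2 W" unfolding n_def by (intro glue_L2 N zero)
  have "(P has_vector_derivative 1) (at 0)" using sl_eqD(2)[OF P(1), of 0] init by simp
  note P_nz = not_AE_zero_half_line(1)[OF this]
  have "(N has_vector_derivative 1) (at 0)" using sl_eqD(2)[OF N(1), of 0] init by simp
  note N_nz = not_AE_zero_half_line(2)[OF this]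
  have "L2_sq W p \<noteq> 0"
  proof
    assume "L2_sq W p = 0"
    with p have "AE x in lebesgue. p x = 0" by (rule L2_sq_W_eq_0_imp)
    then have "AE x in lebesgue. 0 < x \<longrightarrow> P x = 0"
      by eventually_elim (auto simp: p_def glue_def)
    then show False using P_nz by blast
  qed
  then have p_pos: "L2_sq W p > 0" using L2_sq_nonneg[of W p] by linarith
  have "L2_sq W n \<noteq> 0"
  proof
    assume "L2_sq W n = 0"
    with n have "AE x in lebesgue. n x = 0" by (rule L2_sq_W_eq_0_imp)
    then have "AE x in lebesgue. x < 0 \<longrightarrow> N x = 0"
      by eventually_elim (auto simp: n_def glue_def)
    then show False using N_nz by blast
  qed
  then have n_pos: "L2_sq W n > 0" using L2_sq_nonneg[of W n] by linarith
  show neq: "\<mu> \<noteq> \<nu>"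
  proof
    assume "\<mu> = \<nu>"
    \<comment> \<open>For equal coefficients \<open>P\<close> and \<open>N\<close> match without
      their conjugates, and the right-hand side of the bound is zero.\<close>
    define h where "h = glue (\<lambda>x. 1 * P x + 0 * cnj (P x)) (\<lambda>x. 1 * N x + 0 * cnj (N x))"
    have h: "h \<in> L2 W" and le: "L2_sq W h \<le> 4 * C * L2_sq W (glue (\<lambda>x. 0 * P x) (\<lambda>x. 0 * N x))"
      unfolding h_def by (rule bound; use \<open>\<mu> = \<nu>\<close> in simp)+
    have "L2_sq W (glue (\<lambda>x. 0 * P x) (\<lambda>x. 0 * N x)) = 0"
      by (simp add: L2_sq_def glue_def)
    then have "L2_sq W h = 0" using le L2_sq_nonneg[of W h] by simp
    with h have "AE x in lebesgue. h x = 0" by (rule L2_sq_W_eq_0_imp)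
    then have "AE x in lebesgue. 0 < x \<longrightarrow> P x = 0"
      by eventually_elim (auto simp: h_def glue_def)
    then show False using P_nz by blast
  qed
  have half: "cmod (1 + b) \<le> 1 + sqrt (8 * C + 2)" if "(cmod b)\<^sup>2 \<le> 2 * (4 * C) + 2" for b
  proof -
    have "cmod b \<le> sqrt (8 * C + 2)" using that by (intro real_le_rsqrt) simp
    then show ?thesis using norm_triangle_ineq[of 1 b] by simp
  qed
  have im: "2 * cmod (of_real (Im \<xi>) / (\<mu> - \<nu>)) = cmod ((\<xi> - cnj \<xi>) / (\<mu> - \<nu>))" for \<xi>
    by (simp add: norm_divide complex_diff_cnj norm_mult)
  show "cmod (of_real (Im \<mu>) / (\<mu> - \<nu>)) \<le> 1 + sqrt (8 * C + 2)"
  proof -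
    \<comment> \<open>The coefficient \<open>1 + a\<close> on the left is forced by matching the
      derivatives, both equal to 1 at 0; matching the values then determines
      \<open>a\<close>.\<close>
    define a where "a = (\<nu> - cnj \<mu>) / (\<mu> - \<nu>)"
    have a1: "1 + a = (\<mu> - cnj \<mu>) / (\<mu> - \<nu>)" using neq by (simp add: a_def field_simps)
    define h where "h = glue (\<lambda>x. a * P x + 1 * cnj (P x)) (\<lambda>x. (1 + a) * N x + 0 * cnj (N x))"
    have m: "a * - \<mu> + 1 * cnj (- \<mu>) = (1 + a) * - \<nu> + 0 * cnj (- \<nu>)"
      using neq by (simp add: a_def field_simps)
    have h: "h \<in> L2 W" and "L2_sq W h \<le> 4 * C * L2_sq W (glue (\<lambda>x. 1 * P x) (\<lambda>x. 0 * N x))"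
      unfolding h_def by (rule bound[OF m]; simp)+
    then have "L2_sq W h \<le> 4 * C * L2_sq W p" by (simp add: p_def)
    then have "(cmod a)\<^sup>2 \<le> 2 * (4 * C) + 2"
    proof (rule coefficient_bound[OF p h _ p_pos])
      show "(cmod (a * p x))\<^sup>2 \<le> 2 * (cmod (h x))\<^sup>2 + 2 * (cmod (p x))\<^sup>2" for x
        using cmod_add_power2_le[of "a * P x + cnj (P x)" "- cnj (P x)"]
        by (auto simp: p_def h_def glue_def)
    qed
    then have "cmod (1 + a) \<le> 1 + sqrt (8 * C + 2)" by (rule half)
    then show ?thesis using im[of \<mu>] norm_ge_zero[of "of_real (Im \<mu>) / (\<mu> - \<nu>)"] unfolding a1 by linarith
  qed
  show "cmod (of_real (Im \<nu>) / (\<mu> - \<nu>)) \<le> 1 + sqrt (8 * C + 2)"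
  proof -
    \<comment> \<open>The mirror image: the conjugate is now added on the left, and matching of
      derivatives and values determines \<open>1 + b\<close> and \<open>b\<close>.\<close>
    define b where "b = (cnj \<nu> - \<mu>) / (\<mu> - \<nu>)"
    have b1: "1 + b = - ((\<nu> - cnj \<nu>) / (\<mu> - \<nu>))" using neq by (simp add: b_def field_simps)
    define h where "h = glue (\<lambda>x. (1 + b) * P x + 0 * cnj (P x)) (\<lambda>x. b * N x + 1 * cnj (N x))"
    have m: "(1 + b) * - \<mu> + 0 * cnj (- \<mu>) = b * - \<nu> + 1 * cnj (- \<nu>)"
      using neq by (simp add: b_def field_simps)
    have h: "h \<in> L2 W" and "L2_sq W h \<le> 4 * C * L2_sq W (glue (\<lambda>x. 0 * P x) (\<lambda>x. 1 * N x))"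
      unfolding h_def by (rule bound[OF m]; simp)+
    then have "L2_sq W h \<le> 4 * C * L2_sq W n" by (simp add: n_def)
    then have "(cmod b)\<^sup>2 \<le> 2 * (4 * C) + 2"
    proof (rule coefficient_bound[OF n h _ n_pos])
      show "(cmod (b * n x))\<^sup>2 \<le> 2 * (cmod (h x))\<^sup>2 + 2 * (cmod (n x))\<^sup>2" for x
        using cmod_add_power2_le[of "b * N x + cnj (N x)" "- cnj (N x)"]
        by (auto simp: n_def h_def glue_def)
    qed
    then have "cmod (1 + b) \<le> 1 + sqrt (8 * C + 2)" by (rule half)
    then show ?thesis using im[of \<nu>] norm_ge_zero[of "of_real (Im \<nu>) / (\<mu> - \<nu>)"]
      unfolding b1 norm_minus_cancel by linarith
  qed
qed

end

section \<open>Application to the Weyl--Titchmarsh coefficients\<close>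

theorem theorem3p1:
  fixes q r :: "real \<Rightarrow> real"
    and c s :: "real \<Rightarrow> complex \<Rightarrow> complex"
    and mp mm :: "complex \<Rightarrow> complex"
  assumes "L1_loc q" and "L1_loc r"
    and "\<And>x. x \<noteq> 0 \<Longrightarrow> x * r x > 0"
    and "self_adjoint_operator (weighted_measure r) (L_operator q r)"
    and "fundamental_system q r c s"
    and "is_m_plus r c s mp" and "is_m_minus r c s mm"
    and "similar_to_self_adjoint (weighted_measure r) (A_operator q r)"
  shows "(\<forall>z. z \<notin> \<real> \<longrightarrow> M_plus mp z - M_minus mm z \<noteq> 0) \<and>
         bounded ((\<lambda>z. of_real (Im (M_plus mp z)) / (M_plus mp z - M_minus mm z)) ` (- \<real>)) \<and>
         bounded ((\<lambda>z. of_real (Im (M_minus mm z)) / (M_plus mp z - M_minus mm z)) ` (- \<real>))"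
proof -
  interpret sl_weight r by unfold_locales (use assms in auto)
  have "A_operator q r \<subseteq> L2 W \<times> L2 W" by (auto simp: A_operator_def sl_operator_def)
  then obtain C where C: "resolvent_bound W (A_operator q r) C"
    using similar_to_self_adjoint_resolvent_bound[OF assms(8)] by blast
  have cs: "sl_eq q (\<lambda>x. c x z) (\<lambda>x. z * of_real \<bar>r x\<bar> * c x z)" "c 0 z = 1" "ddx (\<lambda>x. c x z) 0 = 0"
    "sl_eq q (\<lambda>x. s x z) (\<lambda>x. z * of_real \<bar>r x\<bar> * s x z)" "s 0 z = 0" "ddx (\<lambda>x. s x z) 0 = 1" for z
    using assms(5) by (auto simp: fundamental_system_def sl_solution_iff_sl_eq)
  have bounds: "M_plus mp z \<noteq> M_minus mm z"
    "cmod (of_real (Im (M_plus mp z)) / (M_plus mp z - M_minus mm z)) \<le> 1 + sqrt (8 * C + 2)"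
    "cmod (of_real (Im (M_minus mm z)) / (M_plus mp z - M_minus mm z)) \<le> 1 + sqrt (8 * C + 2)"
    if z: "z \<notin> \<real>" for z
  proof -
    \<comment> \<open>The Weyl solutions for the weight \<open>r\<close> at \<open>z\<close>; on the
      left the parameter is \<open>- z\<close>, since \<open>r\<close> is negative there. Their
      values at 0 are \<open>- M_plus mp z\<close> and \<open>- M_minus mm z\<close>. The factor 1
      fits the form of \<open>sl_eq_linear_combination\<close>.\<close>
    define P where "P x = 1 * s x z + (- mp z) * c x z" for x
    define N where "N x = 1 * s x (- z) + mm (- z) * c x (- z)" for x
    have Im: "Im z \<noteq> 0" using z complex_is_Real_iff by blast
    have "- z \<notin> \<real>" using z by (metis Reals_minus minus_minus)
    then have L2: "P \<in> L2 (restrict_space W {0..})" "N \<in> L2 (restrict_space W {..0})"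
      using assms(6,7) z by (simp_all add: is_m_plus_def is_m_minus_def P_def[abs_def] N_def[abs_def])
    have P: "sl_eq q P (\<lambda>x. z * of_real \<bar>r x\<bar> * P x)"
      using sl_eq_linear_combination(1)[OF cs(4) cs(1), of 1 z "- mp z" z]
      unfolding P_def[abs_def] by (simp add: algebra_simps)
    have N: "sl_eq q N (\<lambda>x. - z * of_real \<bar>r x\<bar> * N x)"
      using sl_eq_linear_combination(1)[OF cs(4) cs(1), of 1 "- z" "mm (- z)" "- z"]
      unfolding N_def[abs_def] by (simp add: algebra_simps)
    have init: "P 0 = - M_plus mp z" "N 0 = - M_minus mm z"
      by (simp_all add: P_def N_def M_plus_def M_minus_def cs)
    have "ddx P 0 = 1" "ddx N 0 = 1"
      unfolding P_def[abs_def] N_def[abs_def] sl_eq_linear_combination(2)[OF cs(4) cs(1)] cs by simp_all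
    note Weyl = Weyl_coefficient_bounds[OF C Im P L2(1) N L2(2) init(1) this(1) init(2) this(2)]
    show "M_plus mp z \<noteq> M_minus mm z"
      "cmod (of_real (Im (M_plus mp z)) / (M_plus mp z - M_minus mm z)) \<le> 1 + sqrt (8 * C + 2)"
      "cmod (of_real (Im (M_minus mm z)) / (M_plus mp z - M_minus mm z)) \<le> 1 + sqrt (8 * C + 2)"
      by (rule Weyl)+
  qed
  show ?thesis
    using bounds by (auto simp: bounded_iff)
qed

end
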